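(* Let $p \geq 17$ be a Fermat prime. Then the Scharlau invariant of $\mathrm{SL}_2(\mathbb{Z}_p)$ is $p$.
   Context: $\mathbb{Z}_p = \mathbb{Z}/p\mathbb{Z}$ denotes the field with $p$ elements. A Fermat prime is a prime of the form $2^{2^n}+1$. For a finite group $G$ and a subset $S \subseteq G$, $\overline{S} = \sum_{s \in S} s \in \mathbb{Z}[G]$. The Scharlau ideal of $G$ is the two-sided ideal $I$ of $\mathbb{Z}[G]$ generated by the elements $\overline{H}$, where $H$ ranges over the non-trivial subgroups of $G$. The Scharlau invariant of $G$ is the non-negative integer which generates the ideal $I \cap \mathbb{Z}$ of $\mathbb{Z}$, where $\mathbb{Z}$ is identified with $\mathbb{Z}\cdot 1 \subseteq \mathbb{Z}[G]$. *)

theory Defs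
  imports "HOL-Algebra.IntRing" "HOL-Number_Theory.Residues"
begin

definition fermat_prime :: "nat \<Rightarrow> bool" where
  "fermat_prime p \<longleftrightarrow> prime p \<and> (\<exists>n. p = 2 ^ (2 ^ n) + 1)"

section \<open>Integral group rings\<close>

text \<open>An element of \<open>\<int>[G]\<close> is its coefficient function, which has finite support
  contained in the carrier; multiplication is convolution.\<close>

definition int_group_ring :: "('a, 'b) monoid_scheme \<Rightarrow> ('a \<Rightarrow> int) ring" where
  "int_group_ring G =
    \<lparr> carrier = {f. finite {x. f x \<noteq> 0} \<and> {x. f x \<noteq> 0} \<subseteq> carrier G},
      monoid.mult = (\<lambda>f g x. \<Sum>(y, z) \<in> {(y, z). f y \<noteq> 0 \<and> g z \<noteq> 0 \<and> y \<otimes>\<^bsub>G\<^esub> z = x}. f y * g z),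
      one = (\<lambda>x. if x = \<one>\<^bsub>G\<^esub> then 1 else 0),
      zero = (\<lambda>_. 0),
      add = (\<lambda>f g x. f x + g x) \<rparr>"

definition basis_elem :: "'a \<Rightarrow> 'a \<Rightarrow> int" where
  "basis_elem g = (\<lambda>x. if x = g then 1 else 0)"

definition subset_sum :: "('a, 'b) monoid_scheme \<Rightarrow> 'a set \<Rightarrow> 'a \<Rightarrow> int" where
  "subset_sum G S = (\<Oplus>\<^bsub>int_group_ring G\<^esub> s \<in> S. basis_elem s)"

lemma int_group_ring_mult_eq:
  assumes "finite A" "finite B" "{x. f x \<noteq> 0} \<subseteq> A" "{x. g x \<noteq> 0} \<subseteq> B"
  shows "(f \<otimes>\<^bsub>int_group_ring G\<^esub> g) x =
    (\<Sum>y\<in>A. \<Sum>z\<in>B. if y \<otimes>\<^bsub>G\<^esub> z = x then f y * g z else 0)"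
proof -
  have "(f \<otimes>\<^bsub>int_group_ring G\<^esub> g) x =
      (\<Sum>(y, z) \<in> {(y, z). f y \<noteq> 0 \<and> g z \<noteq> 0 \<and> y \<otimes>\<^bsub>G\<^esub> z = x}. f y * g z)"
    by (simp add: int_group_ring_def)
  also have "\<dots> = (\<Sum>(y, z) \<in> A \<times> B. if y \<otimes>\<^bsub>G\<^esub> z = x then f y * g z else 0)"
    by (rule sum.mono_neutral_cong_left) (use assms in \<open>auto split: if_splits\<close>)
  finally show ?thesis
    by (simp add: sum.cartesian_product)
qed

lemma int_group_ring_ring:
  assumes "group G"
  shows "ring (int_group_ring G)"
proof -
  interpret group G by fact
  let ?R = "int_group_ring G"
  define supp :: "('a \<Rightarrow> int) \<Rightarrow> 'a set" where "supp f = {x. f x \<noteq> 0}" for f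
  have car: "f \<in> carrier ?R \<longleftrightarrow> finite (supp f) \<and> supp f \<subseteq> carrier G" for f
    by (simp add: int_group_ring_def supp_def)
  have add: "(f \<oplus>\<^bsub>?R\<^esub> g) x = f x + g x" for f g x
    by (simp add: int_group_ring_def)
  have m: "(f \<otimes>\<^bsub>?R\<^esub> g) x = (\<Sum>y\<in>A. \<Sum>z\<in>B. if y \<otimes>\<^bsub>G\<^esub> z = x then f y * g z else 0)"
    if "finite A" "finite B" "supp f \<subseteq> A" "supp g \<subseteq> B" for A B f g x
    using that unfolding supp_def by (rule int_group_ring_mult_eq)
  have msupp: "supp (f \<otimes>\<^bsub>?R\<^esub> g) \<subseteq> (\<lambda>(y, z). y \<otimes>\<^bsub>G\<^esub> z) ` (supp f \<times> supp g)"
    if "f \<in> carrier ?R" "g \<in> carrier ?R" for f g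
  proof
    fix x assume x: "x \<in> supp (f \<otimes>\<^bsub>?R\<^esub> g)"
    show "x \<in> (\<lambda>(y, z). y \<otimes>\<^bsub>G\<^esub> z) ` (supp f \<times> supp g)"
    proof (rule ccontr)
      assume "\<not> ?thesis"
      then have "(f \<otimes>\<^bsub>?R\<^esub> g) x = 0"
        using that by (subst m[of "supp f" "supp g"]) (auto simp: car intro!: sum.neutral)
      with x show False by (simp add: supp_def)
    qed
  qed
  have addsupp: "supp (f \<oplus>\<^bsub>?R\<^esub> g) \<subseteq> supp f \<union> supp g" for f g
    by (auto simp: supp_def add)
  have one: "\<one>\<^bsub>?R\<^esub> = (\<lambda>x. if x = \<one>\<^bsub>G\<^esub> then 1 else 0)" and zero: "\<zero>\<^bsub>?R\<^esub> = (\<lambda>x. 0)"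
    by (simp_all add: int_group_ring_def)
  have closed: "f \<otimes>\<^bsub>?R\<^esub> g \<in> carrier ?R" if "f \<in> carrier ?R" "g \<in> carrier ?R" for f g
    unfolding car
  proof
    show "finite (supp (f \<otimes>\<^bsub>?R\<^esub> g))"
      using that by (intro finite_subset[OF msupp]) (auto simp: car)
    show "supp (f \<otimes>\<^bsub>?R\<^esub> g) \<subseteq> carrier G"
      using msupp[OF that] that by (fastforce simp: car)
  qed
  have aclosed: "f \<oplus>\<^bsub>?R\<^esub> g \<in> carrier ?R" if "f \<in> carrier ?R" "g \<in> carrier ?R" for f g
    unfolding car
    using addsupp[of f g] that by (auto simp: car intro: finite_subset)
  have onesupp: "supp \<one>\<^bsub>?R\<^esub> = {\<one>\<^bsub>G\<^esub>}"
    by (auto simp: supp_def one)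
  have one1: "\<one>\<^bsub>?R\<^esub> \<one>\<^bsub>G\<^esub> = 1"
    by (simp add: one)
  show ?thesis
  proof (rule ringI)
    show "abelian_group ?R"
    proof (rule abelian_groupI)
      fix f assume f: "f \<in> carrier ?R"
      have "supp (\<lambda>x. - f x) = supp f" by (simp add: supp_def)
      then show "\<exists>g\<in>carrier ?R. g \<oplus>\<^bsub>?R\<^esub> f = \<zero>\<^bsub>?R\<^esub>"
        using f by (intro bexI[of _ "\<lambda>x. - f x"]) (auto simp: car add zero fun_eq_iff)
    qed (auto simp: aclosed fun_eq_iff add zero, simp add: int_group_ring_def)
  next
    show "Group.monoid ?R"
    proof (rule monoidI)
      fix f g h assume fgh: "f \<in> carrier ?R" "g \<in> carrier ?R" "h \<in> carrier ?R"
      define A B C where "A = supp f" and "B = supp g" and "C = supp h"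
      have fin: "finite A" "finite B" "finite C"
        and sub: "A \<subseteq> carrier G" "B \<subseteq> carrier G" "C \<subseteq> carrier G"
        using fgh by (auto simp: A_def B_def C_def car)
      define AB where "AB = (\<lambda>(y, z). y \<otimes>\<^bsub>G\<^esub> z) ` (A \<times> B)"
      define BC where "BC = (\<lambda>(y, z). y \<otimes>\<^bsub>G\<^esub> z) ` (B \<times> C)"
      have fin': "finite AB" "finite BC" using fin by (auto simp: AB_def BC_def)
      show "f \<otimes>\<^bsub>?R\<^esub> g \<otimes>\<^bsub>?R\<^esub> h = f \<otimes>\<^bsub>?R\<^esub> (g \<otimes>\<^bsub>?R\<^esub> h)"
      proof
        fix x
        have "(f \<otimes>\<^bsub>?R\<^esub> g \<otimes>\<^bsub>?R\<^esub> h) x =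
            (\<Sum>u\<in>AB. \<Sum>c\<in>C. if u \<otimes>\<^bsub>G\<^esub> c = x then (f \<otimes>\<^bsub>?R\<^esub> g) u * h c else 0)"
          using fin fin' msupp[OF fgh(1,2)] by (intro m) (auto simp: AB_def A_def B_def C_def)
        also have "\<dots> = (\<Sum>u\<in>AB. \<Sum>c\<in>C. \<Sum>a\<in>A. \<Sum>b\<in>B.
            if u = a \<otimes>\<^bsub>G\<^esub> b then if u \<otimes>\<^bsub>G\<^esub> c = x then f a * g b * h c else 0 else 0)"
        proof (intro sum.cong refl)
          fix u c
          have "(f \<otimes>\<^bsub>?R\<^esub> g) u = (\<Sum>a\<in>A. \<Sum>b\<in>B. if a \<otimes>\<^bsub>G\<^esub> b = u then f a * g b else 0)"
            using fin by (intro m) (auto simp: A_def B_def)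
          then show "(if u \<otimes>\<^bsub>G\<^esub> c = x then (f \<otimes>\<^bsub>?R\<^esub> g) u * h c else 0) = (\<Sum>a\<in>A. \<Sum>b\<in>B.
            if u = a \<otimes>\<^bsub>G\<^esub> b then if u \<otimes>\<^bsub>G\<^esub> c = x then f a * g b * h c else 0 else 0)"
            by (auto simp: sum_distrib_right intro!: sum.cong sum.neutral)
        qed
        also have "\<dots> = (\<Sum>c\<in>C. \<Sum>u\<in>AB. \<Sum>a\<in>A. \<Sum>b\<in>B.
            if u = a \<otimes>\<^bsub>G\<^esub> b then if u \<otimes>\<^bsub>G\<^esub> c = x then f a * g b * h c else 0 else 0)"
          by (rule sum.swap)
        also have "\<dots> = (\<Sum>c\<in>C. \<Sum>a\<in>A. \<Sum>u\<in>AB. \<Sum>b\<in>B.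
            if u = a \<otimes>\<^bsub>G\<^esub> b then if u \<otimes>\<^bsub>G\<^esub> c = x then f a * g b * h c else 0 else 0)"
          by (rule sum.cong[OF refl], rule sum.swap)
        also have "\<dots> = (\<Sum>c\<in>C. \<Sum>a\<in>A. \<Sum>b\<in>B. \<Sum>u\<in>AB.
            if u = a \<otimes>\<^bsub>G\<^esub> b then if u \<otimes>\<^bsub>G\<^esub> c = x then f a * g b * h c else 0 else 0)"
          by (rule sum.cong[OF refl], rule sum.cong[OF refl], rule sum.swap)
        also have "\<dots> = (\<Sum>c\<in>C. \<Sum>a\<in>A. \<Sum>b\<in>B.
            if a \<otimes>\<^bsub>G\<^esub> b \<otimes>\<^bsub>G\<^esub> c = x then f a * g b * h c else 0)"
        proof (intro sum.cong refl)
          fix a b c assume "a \<in> A" "b \<in> B"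
          then have "a \<otimes>\<^bsub>G\<^esub> b \<in> AB" by (auto simp: AB_def)
          then show "(\<Sum>u\<in>AB. if u = a \<otimes>\<^bsub>G\<^esub> b then if u \<otimes>\<^bsub>G\<^esub> c = x then f a * g b * h c else 0 else 0)
            = (if a \<otimes>\<^bsub>G\<^esub> b \<otimes>\<^bsub>G\<^esub> c = x then f a * g b * h c else 0)"
            using fin' by (subst sum.delta) auto
        qed
        also have "\<dots> = (\<Sum>a\<in>A. \<Sum>c\<in>C. \<Sum>b\<in>B.
            if a \<otimes>\<^bsub>G\<^esub> b \<otimes>\<^bsub>G\<^esub> c = x then f a * g b * h c else 0)"
          by (rule sum.swap)
        also have "\<dots> = (\<Sum>a\<in>A. \<Sum>b\<in>B. \<Sum>c\<in>C.
            if a \<otimes>\<^bsub>G\<^esub> b \<otimes>\<^bsub>G\<^esub> c = x then f a * g b * h c else 0)"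
          by (rule sum.cong[OF refl], rule sum.swap)
        also have "\<dots> = (\<Sum>a\<in>A. \<Sum>b\<in>B. \<Sum>c\<in>C. \<Sum>v\<in>BC.
            if v = b \<otimes>\<^bsub>G\<^esub> c then if a \<otimes>\<^bsub>G\<^esub> v = x then f a * g b * h c else 0 else 0)"
        proof (intro sum.cong refl)
          fix a b c assume abc: "a \<in> A" "b \<in> B" "c \<in> C"
          then have "b \<otimes>\<^bsub>G\<^esub> c \<in> BC" by (auto simp: BC_def)
          moreover have "a \<otimes>\<^bsub>G\<^esub> b \<otimes>\<^bsub>G\<^esub> c = a \<otimes>\<^bsub>G\<^esub> (b \<otimes>\<^bsub>G\<^esub> c)"
            using abc sub by (intro m_assoc) auto
          ultimately show "(if a \<otimes>\<^bsub>G\<^esub> b \<otimes>\<^bsub>G\<^esub> c = x then f a * g b * h c else 0) =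
            (\<Sum>v\<in>BC. if v = b \<otimes>\<^bsub>G\<^esub> c then if a \<otimes>\<^bsub>G\<^esub> v = x then f a * g b * h c else 0 else 0)"
            using fin' by (subst sum.delta) auto
        qed
        also have "\<dots> = (\<Sum>a\<in>A. \<Sum>b\<in>B. \<Sum>v\<in>BC. \<Sum>c\<in>C.
            if v = b \<otimes>\<^bsub>G\<^esub> c then if a \<otimes>\<^bsub>G\<^esub> v = x then f a * g b * h c else 0 else 0)"
          by (rule sum.cong[OF refl], rule sum.cong[OF refl], rule sum.swap)
        also have "\<dots> = (\<Sum>a\<in>A. \<Sum>v\<in>BC. \<Sum>b\<in>B. \<Sum>c\<in>C.
            if v = b \<otimes>\<^bsub>G\<^esub> c then if a \<otimes>\<^bsub>G\<^esub> v = x then f a * g b * h c else 0 else 0)"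
          by (rule sum.cong[OF refl], rule sum.swap)
        also have "\<dots> = (\<Sum>a\<in>A. \<Sum>v\<in>BC. if a \<otimes>\<^bsub>G\<^esub> v = x then f a * (g \<otimes>\<^bsub>?R\<^esub> h) v else 0)"
        proof (intro sum.cong refl)
          fix a v
          have "(g \<otimes>\<^bsub>?R\<^esub> h) v = (\<Sum>b\<in>B. \<Sum>c\<in>C. if b \<otimes>\<^bsub>G\<^esub> c = v then g b * h c else 0)"
            using fin by (intro m) (auto simp: C_def B_def)
          then show "(\<Sum>b\<in>B. \<Sum>c\<in>C. if v = b \<otimes>\<^bsub>G\<^esub> c then if a \<otimes>\<^bsub>G\<^esub> v = x then f a * g b * h c else 0 else 0)
            = (if a \<otimes>\<^bsub>G\<^esub> v = x then f a * (g \<otimes>\<^bsub>?R\<^esub> h) v else 0)"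
            by (auto simp: sum_distrib_left intro!: sum.cong sum.neutral)
        qed
        also have "\<dots> = (f \<otimes>\<^bsub>?R\<^esub> (g \<otimes>\<^bsub>?R\<^esub> h)) x"
          using fin fin' msupp[OF fgh(2,3)]
          by (intro m[symmetric]) (auto simp: BC_def A_def B_def C_def)
        finally show "(f \<otimes>\<^bsub>?R\<^esub> g \<otimes>\<^bsub>?R\<^esub> h) x = (f \<otimes>\<^bsub>?R\<^esub> (g \<otimes>\<^bsub>?R\<^esub> h)) x" .
      qed
    next
      fix f assume f: "f \<in> carrier ?R"
      show "\<one>\<^bsub>?R\<^esub> \<otimes>\<^bsub>?R\<^esub> f = f"
      proof
        fix x
        have "(\<one>\<^bsub>?R\<^esub> \<otimes>\<^bsub>?R\<^esub> f) x = (\<Sum>z\<in>supp f. if \<one>\<^bsub>G\<^esub> \<otimes>\<^bsub>G\<^esub> z = x then f z else 0)"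
          using f by (subst m[of "{\<one>\<^bsub>G\<^esub>}" "supp f"]) (auto simp: onesupp car one1 cong: if_cong)
        also have "\<dots> = (\<Sum>z\<in>supp f. if z = x then f z else 0)"
          using f by (intro sum.cong) (auto simp: car)
        also have "\<dots> = f x"
          using f by (subst sum.delta) (auto simp: car supp_def)
        finally show "(\<one>\<^bsub>?R\<^esub> \<otimes>\<^bsub>?R\<^esub> f) x = f x" .
      qed
      show "f \<otimes>\<^bsub>?R\<^esub> \<one>\<^bsub>?R\<^esub> = f"
      proof
        fix x
        have "(f \<otimes>\<^bsub>?R\<^esub> \<one>\<^bsub>?R\<^esub>) x = (\<Sum>z\<in>supp f. if z \<otimes>\<^bsub>G\<^esub> \<one>\<^bsub>G\<^esub> = x then f z else 0)"
          using f by (subst m[of "supp f" "{\<one>\<^bsub>G\<^esub>}"]) (auto simp: onesupp car one1 cong: if_cong)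
        also have "\<dots> = (\<Sum>z\<in>supp f. if z = x then f z else 0)"
          using f by (intro sum.cong) (auto simp: car)
        also have "\<dots> = f x"
          using f by (subst sum.delta) (auto simp: car supp_def)
        finally show "(f \<otimes>\<^bsub>?R\<^esub> \<one>\<^bsub>?R\<^esub>) x = f x" .
      qed
    qed (use closed in blast, simp add: car onesupp)
  next
    fix f g h assume fgh: "f \<in> carrier ?R" "g \<in> carrier ?R" "h \<in> carrier ?R"
    define A C where "A = supp f \<union> supp g" and "C = supp h"
    have fin: "finite A" "finite C" using fgh by (auto simp: A_def C_def car)
    show "(f \<oplus>\<^bsub>?R\<^esub> g) \<otimes>\<^bsub>?R\<^esub> h = f \<otimes>\<^bsub>?R\<^esub> h \<oplus>\<^bsub>?R\<^esub> g \<otimes>\<^bsub>?R\<^esub> h"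
    proof
      fix x
      have "((f \<oplus>\<^bsub>?R\<^esub> g) \<otimes>\<^bsub>?R\<^esub> h) x
          = (\<Sum>y\<in>A. \<Sum>z\<in>C. if y \<otimes>\<^bsub>G\<^esub> z = x then (f \<oplus>\<^bsub>?R\<^esub> g) y * h z else 0)"
        using fin addsupp[of f g] by (intro m) (auto simp: A_def C_def)
      also have "\<dots> = (\<Sum>y\<in>A. \<Sum>z\<in>C. if y \<otimes>\<^bsub>G\<^esub> z = x then f y * h z else 0)
          + (\<Sum>y\<in>A. \<Sum>z\<in>C. if y \<otimes>\<^bsub>G\<^esub> z = x then g y * h z else 0)"
        unfolding sum.distrib[symmetric] by (intro sum.cong) (auto simp: add distrib_right)
      also have "\<dots> = (f \<otimes>\<^bsub>?R\<^esub> h \<oplus>\<^bsub>?R\<^esub> g \<otimes>\<^bsub>?R\<^esub> h) x"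
        unfolding add using fin by (intro arg_cong2[of _ _ _ _ "(+)"] m[symmetric]) (auto simp: A_def C_def)
      finally show "((f \<oplus>\<^bsub>?R\<^esub> g) \<otimes>\<^bsub>?R\<^esub> h) x = (f \<otimes>\<^bsub>?R\<^esub> h \<oplus>\<^bsub>?R\<^esub> g \<otimes>\<^bsub>?R\<^esub> h) x" .
    qed
    show "h \<otimes>\<^bsub>?R\<^esub> (f \<oplus>\<^bsub>?R\<^esub> g) = h \<otimes>\<^bsub>?R\<^esub> f \<oplus>\<^bsub>?R\<^esub> h \<otimes>\<^bsub>?R\<^esub> g"
    proof
      fix x
      have "(h \<otimes>\<^bsub>?R\<^esub> (f \<oplus>\<^bsub>?R\<^esub> g)) x
          = (\<Sum>y\<in>C. \<Sum>z\<in>A. if y \<otimes>\<^bsub>G\<^esub> z = x then h y * (f \<oplus>\<^bsub>?R\<^esub> g) z else 0)"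
        using fin addsupp[of f g] by (intro m) (auto simp: A_def C_def)
      also have "\<dots> = (\<Sum>y\<in>C. \<Sum>z\<in>A. if y \<otimes>\<^bsub>G\<^esub> z = x then h y * f z else 0)
          + (\<Sum>y\<in>C. \<Sum>z\<in>A. if y \<otimes>\<^bsub>G\<^esub> z = x then h y * g z else 0)"
        unfolding sum.distrib[symmetric] by (intro sum.cong) (auto simp: add distrib_left)
      also have "\<dots> = (h \<otimes>\<^bsub>?R\<^esub> f \<oplus>\<^bsub>?R\<^esub> h \<otimes>\<^bsub>?R\<^esub> g) x"
        unfolding add using fin by (intro arg_cong2[of _ _ _ _ "(+)"] m[symmetric]) (auto simp: A_def C_def)
      finally show "(h \<otimes>\<^bsub>?R\<^esub> (f \<oplus>\<^bsub>?R\<^esub> g)) x = (h \<otimes>\<^bsub>?R\<^esub> f \<oplus>\<^bsub>?R\<^esub> h \<otimes>\<^bsub>?R\<^esub> g) x" .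
    qed
  qed
qed

lemma subset_sum_eq:
  assumes "group G" "finite S" "S \<subseteq> carrier G"
  shows "subset_sum G S = (\<lambda>x. if x \<in> S then 1 else 0)"
  using assms(2,3)
proof (induction S rule: finite_induct)
  case empty
  interpret ring "int_group_ring G" by (rule int_group_ring_ring[OF assms(1)])
  show ?case by (simp add: subset_sum_def) (simp add: int_group_ring_def)
next
  case (insert s S)
  interpret ring "int_group_ring G" by (rule int_group_ring_ring[OF assms(1)])
  have "basis_elem t \<in> carrier (int_group_ring G)" if "t \<in> insert s S" for t
    using that insert.prems by (auto simp: int_group_ring_def basis_elem_def)
  then have "subset_sum G (insert s S) = basis_elem s \<oplus>\<^bsub>int_group_ring G\<^esub> subset_sum G S"
    unfolding subset_sum_def using insert.hyps by (intro finsum_insert) auto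
  also have "\<dots> = (\<lambda>x. if x \<in> insert s S then 1 else 0)"
    using insert by (auto simp: int_group_ring_def basis_elem_def fun_eq_iff)
  finally show ?case .
qed

section \<open>The Scharlau ideal and the Scharlau invariant\<close>

definition scharlau_ideal :: "('a, 'b) monoid_scheme \<Rightarrow> ('a \<Rightarrow> int) set" where
  "scharlau_ideal G =
    Idl\<^bsub>int_group_ring G\<^esub> {subset_sum G H | H. subgroup H G \<and> H \<noteq> {\<one>\<^bsub>G\<^esub>}}"

definition scharlau_invariant :: "('a, 'b) monoid_scheme \<Rightarrow> nat" where
  "scharlau_invariant G = (THE d.
    {k::int. [k] \<cdot>\<^bsub>int_group_ring G\<^esub> \<one>\<^bsub>int_group_ring G\<^esub> \<in> scharlau_ideal G} = Idl\<^bsub>\<Z>\<^esub> {int d})"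

section \<open>Special linear groups of degree two\<close>

text \<open>The tuple \<open>(a, b, c, d)\<close> is the matrix with rows \<open>(a, b)\<close> and \<open>(c, d)\<close>.\<close>

definition SL2 :: "('a, 'b) ring_scheme \<Rightarrow> ('a \<times> 'a \<times> 'a \<times> 'a) monoid" where
  "SL2 R =
    \<lparr> carrier = {(a, b, c, d). a \<in> carrier R \<and> b \<in> carrier R \<and> c \<in> carrier R \<and> d \<in> carrier R \<and>
        a \<otimes>\<^bsub>R\<^esub> d \<ominus>\<^bsub>R\<^esub> b \<otimes>\<^bsub>R\<^esub> c = \<one>\<^bsub>R\<^esub>},
      monoid.mult = (\<lambda>(a, b, c, d) (a', b', c', d').
        (a \<otimes>\<^bsub>R\<^esub> a' \<oplus>\<^bsub>R\<^esub> b \<otimes>\<^bsub>R\<^esub> c', a \<otimes>\<^bsub>R\<^esub> b' \<oplus>\<^bsub>R\<^esub> b \<otimes>\<^bsub>R\<^esub> d',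
         c \<otimes>\<^bsub>R\<^esub> a' \<oplus>\<^bsub>R\<^esub> d \<otimes>\<^bsub>R\<^esub> c', c \<otimes>\<^bsub>R\<^esub> b' \<oplus>\<^bsub>R\<^esub> d \<otimes>\<^bsub>R\<^esub> d')),
      one = (\<one>\<^bsub>R\<^esub>, \<zero>\<^bsub>R\<^esub>, \<zero>\<^bsub>R\<^esub>, \<one>\<^bsub>R\<^esub>) \<rparr>"

lemma (in cring) SL2_group: "group (SL2 R)"
proof (rule groupI)
  fix x y assume "x \<in> carrier (SL2 R)" "y \<in> carrier (SL2 R)"
  then obtain a b c d a' b' c' d' where xy: "x = (a, b, c, d)" "y = (a', b', c', d')"
    and car: "a \<in> carrier R" "b \<in> carrier R" "c \<in> carrier R" "d \<in> carrier R"
      "a' \<in> carrier R" "b' \<in> carrier R" "c' \<in> carrier R" "d' \<in> carrier R"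
    and det: "a \<otimes> d \<ominus> b \<otimes> c = \<one>" "a' \<otimes> d' \<ominus> b' \<otimes> c' = \<one>"
    by (auto simp: SL2_def)
  have "(a \<otimes> a' \<oplus> b \<otimes> c') \<otimes> (c \<otimes> b' \<oplus> d \<otimes> d') \<ominus> (a \<otimes> b' \<oplus> b \<otimes> d') \<otimes> (c \<otimes> a' \<oplus> d \<otimes> c')
      = (a \<otimes> d \<ominus> b \<otimes> c) \<otimes> (a' \<otimes> d' \<ominus> b' \<otimes> c')"
    using car by algebra
  with det car show "x \<otimes>\<^bsub>SL2 R\<^esub> y \<in> carrier (SL2 R)"
    by (simp add: SL2_def xy)
next
  fix x y z assume "x \<in> carrier (SL2 R)" "y \<in> carrier (SL2 R)" "z \<in> carrier (SL2 R)"
  then show "x \<otimes>\<^bsub>SL2 R\<^esub> y \<otimes>\<^bsub>SL2 R\<^esub> z = x \<otimes>\<^bsub>SL2 R\<^esub> (y \<otimes>\<^bsub>SL2 R\<^esub> z)"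
    by (auto simp: SL2_def l_distr r_distr m_assoc a_ac)
next
  fix x assume "x \<in> carrier (SL2 R)"
  then obtain a b c d where x: "x = (a, b, c, d)"
    and car: "a \<in> carrier R" "b \<in> carrier R" "c \<in> carrier R" "d \<in> carrier R"
    and det: "a \<otimes> d \<ominus> b \<otimes> c = \<one>"
    by (auto simp: SL2_def)
  have "d \<otimes> a \<ominus> \<ominus> b \<otimes> \<ominus> c = \<one>" "d \<otimes> a \<oplus> \<ominus> b \<otimes> c = \<one>" "\<ominus> c \<otimes> b \<oplus> a \<otimes> d = \<one>"
    "d \<otimes> b \<oplus> \<ominus> b \<otimes> d = \<zero>" "\<ominus> c \<otimes> a \<oplus> a \<otimes> c = \<zero>"
    using det car by algebra+
  then show "\<exists>y\<in>carrier (SL2 R). y \<otimes>\<^bsub>SL2 R\<^esub> x = \<one>\<^bsub>SL2 R\<^esub>"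
    using car by (intro bexI[of _ "(d, \<ominus> b, \<ominus> c, a)"]) (auto simp: SL2_def x)
qed (auto simp: SL2_def minus_eq)

end

theory Submission
  imports Defs
begin

text \<open>
  Let \<open>G\<close> be the special linear group and \<open>A\<close> the quotient of its integral group ring by the
  Scharlau ideal. The theorem says that an integer vanishes in \<open>A\<close> exactly if \<open>p\<close> divides it.

  That nothing else vanishes is seen in the natural representation of \<open>G\<close> by matrices modulo \<open>p\<close>:
  it annihilates the sum \<open>S\<close> of every nontrivial subgroup \<open>H\<close>
  (\<open>subgroup_sum_entry\<close>). If some \<open>h\<close> in \<open>H\<close> has trace different from 2, it fixes no nonzero
  vector, and \<open>h S = S\<close> forces \<open>S = 0\<close>. Otherwise \<open>H\<close> contains some \<open>1 + N \<noteq> 1\<close> with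
  \<open>N\<^sup>2 = 0\<close>, and the sum already vanishes over each coset of the group of its powers.

  That \<open>p\<close> vanishes (\<open>characteristic_in_scharlau_ideal\<close>) needs only subgroups of order 2, 3 and
  \<open>p\<close>. The first two kinds yield \<open>g + g\<^sup>-\<^sup>1 = tr g\<close> in \<open>A\<close> whenever the trace of \<open>g\<close> is 0 or 1.
  Applied to two such elements with product \<open>u\<close>, an elementary unipotent matrix, these relations
  make \<open>u + u\<^sup>-\<^sup>1\<close> commute with both (\<open>inverse_sum_commutes\<close>), hence with all of \<open>G\<close>, so
  that this sum depends only on the conjugacy class of \<open>u\<close>. Here the hypothesis on \<open>p\<close> enters: for a
  Fermat prime \<open>p \<ge> 17\<close> the number 2 is a square modulo \<open>p\<close> (\<open>fermat_prime_sqrt_two\<close>), so \<open>u\<close>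
  is conjugate to \<open>u\<^sup>2\<close>. The resulting equation \<open>u + u\<^sup>-\<^sup>1 = u\<^sup>2 + u\<^sup>-\<^sup>2\<close> makes \<open>T = u\<^sup>3\<close>
  satisfy \<open>(T - 1)\<^sup>2 = 0\<close> (\<open>cube_unipotent\<close>). Since \<open>T\<^sup>p = 1\<close> and the powers of \<open>T\<close> sum to
  0, as the sum over a subgroup of order \<open>p\<close>, this leaves \<open>p = 0\<close> (\<open>unipotent_char\<close>).
\<close>

section \<open>Computations in noncommutative rings\<close>

text \<open>The hypotheses say that \<open>W\<close> and \<open>X = W \<otimes> U\<close> satisfy the characteristic polynomials of
  matrices of determinant one and of trace 0 and 1, so that \<open>- W\<close> and \<open>\<one> - X\<close> are their
  inverses. The sum \<open>U + V\<close> of \<open>U = - W \<otimes> X\<close> and its inverse then behaves like a trace and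
  commutes with \<open>W\<close>: both products equal \<open>W \<otimes> U + U \<otimes> W - \<one>\<close>.\<close>

lemma (in ring) inverse_sum_commutes:
  assumes car: "W \<in> carrier R" "U \<in> carrier R" "V \<in> carrier R"
    and UV: "U \<otimes> V = \<one>" and W2: "W \<otimes> W = \<ominus> \<one>"
    and X2: "W \<otimes> U \<otimes> (W \<otimes> U) = W \<otimes> U \<ominus> \<one>"
  shows "W \<otimes> (U \<oplus> V) = (U \<oplus> V) \<otimes> W"
proof -
  have "W \<otimes> U \<otimes> W = W \<otimes> U \<otimes> (W \<otimes> U) \<otimes> V"
    using car UV by (simp add: m_assoc)
  also have "\<dots> = W \<ominus> V"
    unfolding X2 using car UV by (simp add: m_assoc minus_eq l_distr l_minus)
  finally have WUW: "W \<otimes> U \<otimes> W = W \<ominus> V" .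
  have V: "V = W \<ominus> W \<otimes> U \<otimes> W"
    unfolding WUW using car by (simp add: minus_eq minus_add r_neg1 r_neg2)
  have "W \<otimes> (W \<otimes> U \<otimes> W) = W \<otimes> W \<otimes> (U \<otimes> W)"
    using car by (simp add: m_assoc)
  then have "W \<otimes> (W \<otimes> U \<otimes> W) = \<ominus> (U \<otimes> W)"
    using car by (simp add: W2 l_minus)
  then have WV: "W \<otimes> V = \<ominus> \<one> \<oplus> U \<otimes> W"
    using car by (subst V) (simp add: minus_eq r_distr r_minus W2)
  have VW: "V \<otimes> W = \<ominus> \<one> \<oplus> W \<otimes> U"
    using car by (subst V) (simp add: minus_eq l_distr l_minus m_assoc W2 r_minus)
  show ?thesis
    using car by (simp add: r_distr l_distr WV VW a_ac)
qed

text \<open>Multiplication of the hypothesis by \<open>U\<^sup>2\<close> factors it as \<open>(U - \<one>) (U\<^sup>3 - \<one>) = 0\<close>. As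
  \<open>U - \<one>\<close> divides \<open>U\<^sup>3 - \<one>\<close>, this gives \<open>(T - \<one>)\<^sup>2 = 0\<close> for \<open>T = U\<^sup>3\<close>, stated in the form
  \<open>T\<^sup>2 = T + (T - \<one>)\<close> that serves as a rewrite rule.\<close>

lemma (in ring) cube_unipotent:
  assumes car: "U \<in> carrier R" "V \<in> carrier R" and UV: "U \<otimes> V = \<one>"
    and eq: "U \<otimes> U \<oplus> V \<otimes> V = U \<oplus> V"
  shows "(U \<otimes> U \<otimes> U) \<otimes> (U \<otimes> U \<otimes> U) = U \<otimes> U \<otimes> U \<oplus> (U \<otimes> U \<otimes> U \<ominus> \<one>)"
proof -
  have UVx: "U \<otimes> (V \<otimes> x) = x" if "x \<in> carrier R" for x
    using that car UV by (simp flip: m_assoc)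
  have "U \<otimes> (U \<otimes> (U \<otimes> U \<oplus> V \<otimes> V)) = U \<otimes> (U \<otimes> (U \<oplus> V))"
    by (simp add: eq)
  then have "U \<otimes> (U \<otimes> (U \<otimes> U)) \<oplus> \<one> = U \<otimes> (U \<otimes> U) \<oplus> U"
    using car by (simp add: r_distr UVx UV)
  then have U4: "U \<otimes> (U \<otimes> (U \<otimes> U)) = U \<otimes> (U \<otimes> U) \<oplus> (U \<ominus> \<one>)"
    using car by (metis (no_types, lifting) a_assoc add.inv_solve_right m_closed minus_eq one_closed a_closed a_inv_closed)
  show ?thesis
    using car by (simp add: m_assoc U4 r_distr minus_eq r_minus a_ac r_neg1 r_neg2)
qed

lemma (in ring) unipotent_power:
  assumes T: "T \<in> carrier R" and T2: "T \<otimes> T = T \<oplus> (T \<ominus> \<one>)"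
  shows "T [^] n = \<one> \<oplus> [(n::nat)] \<cdot> (T \<ominus> \<one>)"
proof (induction n)
  case (Suc n)
  have "(T \<ominus> \<one>) \<otimes> T = T \<ominus> \<one>"
    using T by (simp add: minus_eq l_distr T2 l_minus) (simp add: a_ac r_neg1 r_neg2 r_neg)
  then have "T [^] Suc n = T \<oplus> [n] \<cdot> (T \<ominus> \<one>)"
    using T by (simp add: Suc.IH l_distr add_pow_ldistr)
  also have "\<dots> = \<one> \<oplus> (T \<ominus> \<one>) \<oplus> [n] \<cdot> (T \<ominus> \<one>)"
    using T by (simp add: minus_eq a_comm[of \<one>] a_assoc l_neg)
  finally show ?case using T by (simp add: a_ac)
qed (use T in simp)

lemma (in ring) unipotent_power_sum:
  assumes T: "T \<in> carrier R" and T2: "T \<otimes> T = T \<oplus> (T \<ominus> \<one>)"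
  shows "(\<Oplus>k\<in>{..<n}. T [^] (k::nat)) = [n] \<cdot> \<one> \<oplus> [(n * (n - 1) div 2)] \<cdot> (T \<ominus> \<one>)"
proof (induction n)
  case (Suc n)
  have *: "Suc n * (Suc n - 1) div 2 = n + n * (n - 1) div 2"
    by (cases n) (auto simp: algebra_simps)
  have "(\<Oplus>k\<in>{..<Suc n}. T [^] k) = T [^] n \<oplus> (\<Oplus>k\<in>{..<n}. T [^] k)"
    unfolding lessThan_Suc using T by (subst finsum_insert) auto
  also have "\<dots> = \<one> \<oplus> [n] \<cdot> (T \<ominus> \<one>) \<oplus> ([n] \<cdot> \<one> \<oplus> [(n * (n - 1) div 2)] \<cdot> (T \<ominus> \<one>))"
    by (subst Suc.IH, subst unipotent_power[OF assms], rule refl)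
  also have "\<dots> = [(Suc n)] \<cdot> \<one> \<oplus> [(Suc n * (Suc n - 1) div 2)] \<cdot> (T \<ominus> \<one>)"
    unfolding * using T by (simp add: add.nat_pow_mult[symmetric] a_ac)
  finally show ?case .
qed (use T in simp)

text \<open>With \<open>N = T - \<one>\<close>, the condition \<open>T\<^sup>n = \<one>\<close> says \<open>n N = 0\<close>. The vanishing power sum
  is \<open>n + (n (n - 1) / 2) N\<close>, and for odd \<open>n\<close> the coefficient of \<open>N\<close> is a multiple of \<open>n\<close>.\<close>

lemma (in ring) unipotent_char:
  assumes T: "T \<in> carrier R" and T2: "T \<otimes> T = T \<oplus> (T \<ominus> \<one>)"
    and "odd n" and Tn: "T [^] n = \<one>" and sum: "(\<Oplus>k\<in>{..<n}. T [^] (k::nat)) = \<zero>"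
  shows "[n] \<cdot> \<one> = \<zero>"
proof -
  have "\<ominus> \<one> \<oplus> (\<one> \<oplus> [n] \<cdot> (T \<ominus> \<one>)) = \<ominus> \<one> \<oplus> \<one>"
    using Tn unfolding unipotent_power[OF T T2] by simp
  then have N: "[n] \<cdot> (T \<ominus> \<one>) = \<zero>"
    using T by (simp add: r_neg1 l_neg)
  have "n * (n - 1) div 2 = n * ((n - 1) div 2)"
    using \<open>odd n\<close> by (auto elim!: oddE)
  then have "[(n * (n - 1) div 2)] \<cdot> (T \<ominus> \<one>) = [((n - 1) div 2)] \<cdot> ([n] \<cdot> (T \<ominus> \<one>))"
    using T by (simp add: add.nat_pow_pow)
  also have "\<dots> = \<zero>" by (simp add: N)
  finally show ?thesis
    using sum unfolding unipotent_power_sum[OF T T2] by simp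
qed

section \<open>Subgroups, cosets and the integral group ring\<close>

lemma (in group) finite_subgroupI:
  assumes "finite H" "H \<subseteq> carrier G" "\<one> \<in> H" "\<forall>x\<in>H. \<forall>y\<in>H. x \<otimes> y \<in> H"
  shows "subgroup H G"
proof (rule subgroupI)
  fix x assume x: "x \<in> H"
  have inj: "inj_on (\<lambda>y. x \<otimes> y) H"
    using assms x by (intro inj_onI) (auto simp: subset_iff)
  have "(\<lambda>y. x \<otimes> y) ` H = H"
    using assms x by (intro endo_inj_surj inj) auto
  then have "\<one> \<in> (\<lambda>y. x \<otimes> y) ` H"
    using assms(3) by simp
  then obtain y where y: "y \<in> H" "x \<otimes> y = \<one>"
    by auto
  have "y \<otimes> x = \<one>"
    by (rule inv_comm) (use y x assms(2) in auto)
  then have "inv x = y"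
    by (rule inv_equality) (use y x assms(2) in auto)
  with y show "inv x \<in> H" by simp
qed (use assms in auto)

lemma (in group) sum_cong_zero_of_cosets:
  fixes F :: "'a \<Rightarrow> int"
  assumes K: "subgroup K G" and H: "subgroup H G" "finite H" and KH: "K \<subseteq> H"
    and F: "\<And>x. x \<in> H \<Longrightarrow> [(\<Sum>k\<in>K. F (k \<otimes> x)) = 0] (mod m)"
  shows "[(\<Sum>x\<in>H. F x) = 0] (mod m)"
proof -
  let ?H = "G\<lparr>carrier := H\<rparr>"
  interpret H: group ?H by (rule subgroup_imp_group[OF H(1)])
  have K': "subgroup K ?H" by (rule subgroup_incl[OF K H(1) KH])
  define C where "C = rcosets\<^bsub>?H\<^esub> K"
  have HC: "\<Union>C = H"
    using H.rcosets_part_G[OF K'] by (simp add: C_def)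
  have "(\<Sum>x\<in>H. F x) = (\<Sum>c\<in>C. \<Sum>x\<in>c. F x)"
  proof -
    have "\<forall>c\<in>C. finite c"
      using H(2) HC by (auto intro: finite_subset)
    moreover have "\<forall>c\<in>C. \<forall>d\<in>C. c \<noteq> d \<longrightarrow> c \<inter> d = {}"
      using H.rcos_disjoint[OF K'] by (simp add: C_def pairwise_def disjnt_def)
    ultimately show ?thesis
      using sum.Union_disjoint[of C F] by (simp add: HC)
  qed
  also have "m dvd \<dots>"
  proof (rule dvd_sum)
    fix c assume "c \<in> C"
    then obtain x where x: "x \<in> H" "c = (\<lambda>k. k \<otimes> x) ` K"
      by (auto simp: C_def RCOSETS_def r_coset_def)
    have "inj_on (\<lambda>k. k \<otimes> x) K"
      using x subgroup.subset[OF K] subgroup.subset[OF H(1)] by (intro inj_onI) (metis right_cancel subsetD)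
    then have "(\<Sum>y\<in>c. F y) = (\<Sum>k\<in>K. F (k \<otimes> x))"
      unfolding x by (simp add: sum.reindex)
    with F[OF x(1)] show "m dvd (\<Sum>y\<in>c. F y)"
      by (simp add: cong_0_iff)
  qed
  finally show ?thesis by (simp add: cong_0_iff)
qed

lemma int_group_ring_uminus:
  assumes "group G" "f \<in> carrier (int_group_ring G)"
  shows "\<ominus>\<^bsub>int_group_ring G\<^esub> f = (\<lambda>x. - f x)"
proof -
  interpret ring "int_group_ring G" by (rule int_group_ring_ring) fact
  show ?thesis
    by (rule minus_equality) (use assms in \<open>auto simp: int_group_ring_def\<close>)
qed

lemma int_group_ring_add_pow:
  assumes "group G" "f \<in> carrier (int_group_ring G)"
  shows "[(k :: int)] \<cdot>\<^bsub>int_group_ring G\<^esub> f = (\<lambda>x. k * f x)"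
proof -
  interpret ring "int_group_ring G" by (rule int_group_ring_ring) fact
  have nat: "[(n :: nat)] \<cdot>\<^bsub>int_group_ring G\<^esub> f = (\<lambda>x. int n * f x)" for n
  proof (induction n)
    case 0
    have "\<zero>\<^bsub>int_group_ring G\<^esub> = (\<lambda>x. 0)" by (simp add: int_group_ring_def)
    then show ?case by simp
  next
    case (Suc n)
    have "[(Suc n)] \<cdot>\<^bsub>int_group_ring G\<^esub> f = (\<lambda>x. int n * f x) \<oplus>\<^bsub>int_group_ring G\<^esub> f"
      by (simp add: Suc.IH)
    then show ?case by (simp add: int_group_ring_def algebra_simps)
  qed
  show ?thesis
  proof (cases "k \<ge> 0")
    case True
    then show ?thesis by (simp add: add_pow_int_ge nat)
  next
    case False
    have "[nat (- k)] \<cdot>\<^bsub>int_group_ring G\<^esub> f \<in> carrier (int_group_ring G)"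
      using assms(2) by simp
    with False show ?thesis
      by (simp add: add_pow_int_lt int_group_ring_uminus[OF assms(1)]) (simp add: nat)
  qed
qed

section \<open>The quotient of the group ring by the Scharlau ideal\<close>

context group
begin

abbreviation scharlau_quotient where
  "scharlau_quotient \<equiv> int_group_ring G Quot scharlau_ideal G"

definition scharlau_class :: "'a \<Rightarrow> ('a \<Rightarrow> int) set" where
  "scharlau_class g = scharlau_ideal G +>\<^bsub>int_group_ring G\<^esub> basis_elem g"

lemma basis_elem_carrier: "g \<in> carrier G \<Longrightarrow> basis_elem g \<in> carrier (int_group_ring G)"
  by (auto simp: int_group_ring_def basis_elem_def)

lemma basis_elem_mult: "basis_elem g \<otimes>\<^bsub>int_group_ring G\<^esub> basis_elem h = basis_elem (g \<otimes> h)"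
proof
  fix x
  show "(basis_elem g \<otimes>\<^bsub>int_group_ring G\<^esub> basis_elem h) x = basis_elem (g \<otimes> h) x"
    by (subst int_group_ring_mult_eq[of "{g}" "{h}"]) (auto simp: basis_elem_def)
qed

lemma basis_elem_one: "basis_elem \<one> = \<one>\<^bsub>int_group_ring G\<^esub>"
  by (auto simp: basis_elem_def int_group_ring_def)

lemma subset_sum_carrier:
  assumes "S \<subseteq> carrier G"
  shows "subset_sum G S \<in> carrier (int_group_ring G)"
proof -
  interpret ZG: ring "int_group_ring G" by (rule int_group_ring_ring) (rule group_axioms)
  show ?thesis
    unfolding subset_sum_def using assms by (intro ZG.finsum_closed) (auto intro: basis_elem_carrier)
qed

lemma scharlau_ideal_ideal: "ideal (scharlau_ideal G) (int_group_ring G)"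
proof -
  interpret ZG: ring "int_group_ring G" by (rule int_group_ring_ring) (rule group_axioms)
  show ?thesis
    unfolding scharlau_ideal_def
    by (intro ZG.genideal_ideal) (auto dest: subgroup.subset intro!: subset_sum_carrier)
qed

lemma subset_sum_in_scharlau_ideal:
  assumes "subgroup H G" "H \<noteq> {\<one>}"
  shows "subset_sum G H \<in> scharlau_ideal G"
proof -
  interpret ZG: ring "int_group_ring G" by (rule int_group_ring_ring) (rule group_axioms)
  have "{subset_sum G H | H. subgroup H G \<and> H \<noteq> {\<one>}} \<subseteq> scharlau_ideal G"
    unfolding scharlau_ideal_def
    by (intro ZG.genideal_self) (auto dest: subgroup.subset intro!: subset_sum_carrier)
  then show ?thesis using assms by blast
qed

lemma scharlau_quotient_ring: "ring scharlau_quotient"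
  by (rule ideal.quotient_is_ring[OF scharlau_ideal_ideal])

lemma scharlau_quotient_zero: "\<zero>\<^bsub>scharlau_quotient\<^esub> = scharlau_ideal G"
  by (simp add: FactRing_def)

lemma scharlau_class_carrier [simp]: "g \<in> carrier G \<Longrightarrow> scharlau_class g \<in> carrier scharlau_quotient"
  unfolding scharlau_class_def
  by (rule ring_hom_memE(1)[OF ideal.rcos_ring_hom[OF scharlau_ideal_ideal]]) (rule basis_elem_carrier)

lemma scharlau_class_mult:
  assumes "g \<in> carrier G" "h \<in> carrier G"
  shows "scharlau_class (g \<otimes> h) = scharlau_class g \<otimes>\<^bsub>scharlau_quotient\<^esub> scharlau_class h"
  unfolding scharlau_class_def basis_elem_mult[symmetric]
  using assms
  by (intro ring_hom_memE(2)[OF ideal.rcos_ring_hom[OF scharlau_ideal_ideal]] basis_elem_carrier)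

lemma scharlau_class_one: "scharlau_class \<one> = \<one>\<^bsub>scharlau_quotient\<^esub>"
  unfolding scharlau_class_def basis_elem_one
  by (rule ring_hom_memE(4)[OF ideal.rcos_ring_hom[OF scharlau_ideal_ideal]])

lemma scharlau_class_subgroup_sum:
  assumes H: "subgroup H G" "H \<noteq> {\<one>}"
  shows "(\<Oplus>\<^bsub>scharlau_quotient\<^esub>h\<in>H. scharlau_class h) = \<zero>\<^bsub>scharlau_quotient\<^esub>"
proof -
  let ?I = "scharlau_ideal G" and ?R = "int_group_ring G"
  interpret ideal ?I ?R by (rule scharlau_ideal_ideal)
  interpret h: ring_hom_ring ?R scharlau_quotient "(+>\<^bsub>?R\<^esub>) ?I" by (rule rcos_ring_hom_ring)
  have "(\<Oplus>\<^bsub>scharlau_quotient\<^esub>h\<in>H. scharlau_class h) = ?I +>\<^bsub>?R\<^esub> subset_sum G H"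
    unfolding subset_sum_def using subgroup.subset[OF H(1)]
    by (subst h.hom_finsum)
       (auto simp: scharlau_class_def[abs_def] comp_def intro!: basis_elem_carrier)
  also have "\<dots> = ?I"
    by (rule a_rcos_zero[OF is_ideal subset_sum_in_scharlau_ideal[OF H]])
  finally show ?thesis by (simp only: scharlau_quotient_zero)
qed

lemma char_in_scharlau_ideal:
  assumes "add_pow scharlau_quotient (n::nat) \<one>\<^bsub>scharlau_quotient\<^esub> = \<zero>\<^bsub>scharlau_quotient\<^esub>"
  shows "[int n] \<cdot>\<^bsub>int_group_ring G\<^esub> \<one>\<^bsub>int_group_ring G\<^esub> \<in> scharlau_ideal G"
proof -
  let ?I = "scharlau_ideal G" and ?R = "int_group_ring G"
  interpret ideal ?I ?R by (rule scharlau_ideal_ideal)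
  interpret h: ring_hom_ring ?R scharlau_quotient "(+>\<^bsub>?R\<^esub>) ?I" by (rule rcos_ring_hom_ring)
  have "?I +>\<^bsub>?R\<^esub> ([k] \<cdot>\<^bsub>?R\<^esub> \<one>\<^bsub>?R\<^esub>) = [k] \<cdot>\<^bsub>scharlau_quotient\<^esub> \<one>\<^bsub>scharlau_quotient\<^esub>" for k :: nat
    by (induction k) simp_all
  from this[of n] have "?I +>\<^bsub>?R\<^esub> ([n] \<cdot>\<^bsub>?R\<^esub> \<one>\<^bsub>?R\<^esub>) = ?I"
    unfolding assms by (simp only: scharlau_quotient_zero)
  then show ?thesis
    by (intro rcos_const_imp_mem) (simp_all add: add_pow_int_ge)
qed

end

section \<open>The special linear group over a residue ring\<close>

text \<open>Arbitrary integer representatives are allowed as entries, so that products are computed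
  without case distinctions and equality becomes congruence.\<close>

definition mat_mod :: "int \<Rightarrow> int \<Rightarrow> int \<Rightarrow> int \<Rightarrow> int \<Rightarrow> int \<times> int \<times> int \<times> int" where
  "mat_mod m a b c d = (a mod m, b mod m, c mod m, d mod m)"

lemma mat_eq_iff:
  "mat_mod m a b c d = mat_mod m a' b' c' d' \<longleftrightarrow>
    [a = a'] (mod m) \<and> [b = b'] (mod m) \<and> [c = c'] (mod m) \<and> [d = d'] (mod m)"
  by (simp add: mat_mod_def cong_def)

lemma mod_mult_add_eq:
  "(a mod m * (b mod m) + c mod m * (d mod m)) mod m = (a * b + c * d) mod (m :: int)"
  by (intro mod_add_cong mod_mult_eq)

lemma mod_mult_diff_eq:
  "(a mod m * (b mod m) - c mod m * (d mod m)) mod m = (a * b - c * d) mod (m :: int)"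
  by (intro mod_diff_cong mod_mult_eq)

context residues
begin

lemma mat_mult:
  "mat_mod m a b c d \<otimes>\<^bsub>SL2 R\<^esub> mat_mod m a' b' c' d' =
    mat_mod m (a * a' + b * c') (a * b' + b * d') (c * a' + d * c') (c * b' + d * d')"
  by (simp add: SL2_def mat_mod_def res_add_eq res_mult_eq mod_simps mod_mult_add_eq)

lemma mat_one: "\<one>\<^bsub>SL2 R\<^esub> = mat_mod m 1 0 0 1"
  using m_gt_one by (simp add: SL2_def mat_mod_def res_one_eq res_zero_eq)

lemma mat_carrier_iff: "mat_mod m a b c d \<in> carrier (SL2 R) \<longleftrightarrow> [a * d - b * c = 1] (mod m)"
  using m_gt_one
  by (simp add: SL2_def mat_mod_def res_carrier_eq res_add_eq res_mult_eq res_one_eq res_neg_eq minus_eq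
      mod_simps mod_mult_diff_eq cong_def)

lemma SL2_carrierE:
  assumes "x \<in> carrier (SL2 R)"
  obtains a b c d where "x = mat_mod m a b c d" "[a * d - b * c = 1] (mod m)"
proof -
  obtain a b c d where x: "x = (a, b, c, d)" by (cases x)
  have "{a, b, c, d} \<subseteq> {0..m - 1}"
    using assms by (auto simp: x SL2_def res_carrier_eq)
  then have "x = mat_mod m a b c d"
    by (simp add: x mat_mod_def)
  then show thesis using that[of a b c d] assms mat_carrier_iff[of a b c d] by simp
qed

lemma finite_SL2: "finite (carrier (SL2 R))"
proof (rule finite_subset)
  show "carrier (SL2 R) \<subseteq> {0..m - 1} \<times> {0..m - 1} \<times> {0..m - 1} \<times> {0..m - 1}"
    by (auto simp: SL2_def res_carrier_eq)
qed auto

end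

section \<open>The prime belongs to the Scharlau ideal\<close>

context residues_prime
begin

abbreviation G where "G \<equiv> SL2 R"

abbreviation M where "M \<equiv> mat_mod (int p)"

lemma unipotent_mult: "M 1 k 0 1 \<otimes>\<^bsub>G\<^esub> M 1 l 0 1 = M 1 (k + l) 0 1"
  by (simp add: mat_mult add.commute)

lemma unipotent_carrier: "M 1 k 0 1 \<in> carrier G"
  by (simp add: mat_carrier_iff)

lemma unipotent_eq_iff: "M 1 k 0 1 = M 1 l 0 1 \<longleftrightarrow> [k = l] (mod int p)"
  by (auto simp: mat_eq_iff)

lemma unipotent_subgroup: "subgroup (range (\<lambda>k. M 1 k 0 1)) G"
proof -
  interpret G: group G by (rule SL2_group)
  show ?thesis
  proof (rule G.finite_subgroupI)
    show "range (\<lambda>k. M 1 k 0 1) \<subseteq> carrier G" by (auto simp: unipotent_carrier)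
    then show "finite (range (\<lambda>k. M 1 k 0 1))" using finite_SL2 by (rule finite_subset)
    show "\<one>\<^bsub>G\<^esub> \<in> range (\<lambda>k. M 1 k 0 1)" by (auto simp: mat_one)
  qed (auto simp: unipotent_mult)
qed

text \<open>Write \<open>u\<close> for the elementary unipotent matrix, \<open>w\<close> for the matrix with rows \<open>(0, -1)\<close> and
  \<open>(1, 0)\<close>, and \<open>x = w u\<close>, which has trace 1 and order 6. Modulo the ideal, the subgroup
  \<open>{1, -1}\<close> identifies the matrix \<open>-1\<close> with the scalar \<open>- \<one>\<close>, and the subgroup generated by
  \<open>x\<^sup>2\<close> gives \<open>x\<^sup>2 = x - \<one>\<close>. Hence \<open>u + u\<^sup>-\<^sup>1\<close> commutes with \<open>w\<close> and \<open>u\<close>, and so with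
  every product of these. A square root \<open>r\<close> of 2 makes \<open>u\<close> conjugate to \<open>u\<^sup>2\<close> by a diagonal
  matrix, which is such a product; therefore \<open>u + u\<^sup>-\<^sup>1 = u\<^sup>2 + u\<^sup>-\<^sup>2\<close>. Thus \<open>u\<^sup>3\<close> is unipotent
  of degree two, while it also has order \<open>p\<close> and the sum of its powers vanishes.\<close>

lemma characteristic_in_scharlau_ideal:
  assumes p: "p > 3" and r: "[r * r = 2] (mod int p)"
  shows "[int p] \<cdot>\<^bsub>int_group_ring G\<^esub> \<one>\<^bsub>int_group_ring G\<^esub> \<in> scharlau_ideal G"
proof -
  interpret G: group G by (rule SL2_group)
  define A where "A = G.scharlau_quotient"
  define e where "e = G.scharlau_class"
  interpret A: ring A unfolding A_def by (rule G.scharlau_quotient_ring)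
  have e_carrier [simp]: "e g \<in> carrier A" if "g \<in> carrier G" for g
    using that unfolding A_def e_def by (rule G.scharlau_class_carrier)
  have e_mult: "e (g \<otimes>\<^bsub>G\<^esub> h) = e g \<otimes>\<^bsub>A\<^esub> e h" if "g \<in> carrier G" "h \<in> carrier G" for g h
    using that unfolding A_def e_def by (rule G.scharlau_class_mult)
  have e_one: "e \<one>\<^bsub>G\<^esub> = \<one>\<^bsub>A\<^esub>"
    unfolding A_def e_def by (rule G.scharlau_class_one)
  have e_sum: "(\<Oplus>\<^bsub>A\<^esub>h\<in>H. e h) = \<zero>\<^bsub>A\<^esub>" if "subgroup H G" "H \<noteq> {\<one>\<^bsub>G\<^esub>}" for H
    using that unfolding A_def e_def by (rule G.scharlau_class_subgroup_sum)
  have not_cong: "\<not> [a = b] (mod int p)" if "\<bar>a - b\<bar> \<in> {1, 2}" for a b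
  proof
    assume "[a = b] (mod int p)"
    then have "\<bar>int p\<bar> \<le> \<bar>a - b\<bar>"
      using that by (intro dvd_imp_le_int) (auto simp: cong_iff_dvd_diff)
    with that have "int p \<le> 2" by auto
    with p show False by simp
  qed
  have p_odd: "odd p"
    using p_prime p prime_odd_nat by auto

  \<comment> \<open>\<open>x2\<close> and \<open>x4\<close> are the squares of \<open>x\<close> and of \<open>x2\<close>; both have order three.\<close>
  define z w x x2 x4 where "z = M (-1) 0 0 (-1)" and "w = M 0 (-1) 1 0"
    and "x = M 0 (-1) 1 1" and "x2 = M (-1) (-1) 1 0" and "x4 = M 0 1 (-1) (-1)"
  define u where "u k = M 1 k 0 1" for k
  have car [simp]: "z \<in> carrier G" "w \<in> carrier G" "x \<in> carrier G" "x2 \<in> carrier G"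
    "x4 \<in> carrier G" "u k \<in> carrier G" for k
    by (simp_all add: z_def w_def x_def x2_def x4_def u_def mat_carrier_iff)
  have u_mult: "u k \<otimes>\<^bsub>G\<^esub> u l = u (k + l)" for k l
    by (simp add: u_def unipotent_mult)
  have u_zero: "u 0 = \<one>\<^bsub>G\<^esub>"
    by (simp add: u_def mat_one)
  have e_u_mult: "e (u k) \<otimes>\<^bsub>A\<^esub> e (u l) = e (u (k + l))" for k l
    by (simp add: u_mult flip: e_mult)

  have z_mult: "z \<otimes>\<^bsub>G\<^esub> z = \<one>\<^bsub>G\<^esub>"
    by (simp add: z_def mat_mult mat_one)
  have z_one: "z \<noteq> \<one>\<^bsub>G\<^esub>"
    by (simp add: z_def mat_one mat_eq_iff not_cong)
  have "subgroup {\<one>\<^bsub>G\<^esub>, z} G"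
    by (rule G.finite_subgroupI) (simp_all add: z_mult)
  then have "(\<Oplus>\<^bsub>A\<^esub>h\<in>{\<one>\<^bsub>G\<^esub>, z}. e h) = \<zero>\<^bsub>A\<^esub>"
    using z_one by (intro e_sum) auto
  then have "\<one>\<^bsub>A\<^esub> \<oplus>\<^bsub>A\<^esub> e z = \<zero>\<^bsub>A\<^esub>"
    using z_one[symmetric] by (simp add: e_one)
  then have ez: "e z = \<ominus>\<^bsub>A\<^esub> \<one>\<^bsub>A\<^esub>"
    by (intro A.minus_equality[symmetric]) (simp_all add: A.a_comm)

  have x2_mult: "x2 \<otimes>\<^bsub>G\<^esub> x2 = x4" "x2 \<otimes>\<^bsub>G\<^esub> x4 = \<one>\<^bsub>G\<^esub>" "x4 \<otimes>\<^bsub>G\<^esub> x2 = \<one>\<^bsub>G\<^esub>" "x4 \<otimes>\<^bsub>G\<^esub> x4 = x2"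
    by (simp_all add: x2_def x4_def mat_mult mat_one)
  have x2_neq: "x2 \<noteq> \<one>\<^bsub>G\<^esub>" "x4 \<noteq> \<one>\<^bsub>G\<^esub>" "x2 \<noteq> x4"
    by (simp_all add: x2_def x4_def mat_one mat_eq_iff not_cong)
  have "subgroup {\<one>\<^bsub>G\<^esub>, x2, x4} G"
    by (rule G.finite_subgroupI) (simp_all add: x2_mult)
  then have "(\<Oplus>\<^bsub>A\<^esub>h\<in>{\<one>\<^bsub>G\<^esub>, x2, x4}. e h) = \<zero>\<^bsub>A\<^esub>"
    using x2_neq by (intro e_sum) auto
  then have x_sum: "\<one>\<^bsub>A\<^esub> \<oplus>\<^bsub>A\<^esub> (e x2 \<oplus>\<^bsub>A\<^esub> e x4) = \<zero>\<^bsub>A\<^esub>"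
    using x2_neq x2_neq(1,2)[symmetric] by (simp add: e_one)
  have "x4 = z \<otimes>\<^bsub>G\<^esub> x" "x2 = x \<otimes>\<^bsub>G\<^esub> x" and x_eq: "x = w \<otimes>\<^bsub>G\<^esub> u 1"
    by (simp_all add: x2_def x4_def x_def z_def w_def u_def mat_mult)
  then have ex4: "e x4 = \<ominus>\<^bsub>A\<^esub> e x" and ex2: "e x2 = e x \<otimes>\<^bsub>A\<^esub> e x"
    by (simp_all add: e_mult ez A.l_minus)
  have "\<ominus>\<^bsub>A\<^esub> (\<one>\<^bsub>A\<^esub> \<ominus>\<^bsub>A\<^esub> e x) = e x \<otimes>\<^bsub>A\<^esub> e x"
    using x_sum unfolding ex4 ex2 by (intro A.minus_equality) (simp_all add: A.minus_eq A.a_ac)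
  then have X2: "e x \<otimes>\<^bsub>A\<^esub> e x = e x \<ominus>\<^bsub>A\<^esub> \<one>\<^bsub>A\<^esub>"
    by (simp add: A.minus_eq A.minus_add A.a_comm)

  have "w \<otimes>\<^bsub>G\<^esub> w = z"
    by (simp add: w_def z_def mat_mult)
  then have W2: "e w \<otimes>\<^bsub>A\<^esub> e w = \<ominus>\<^bsub>A\<^esub> \<one>\<^bsub>A\<^esub>"
    by (simp add: ez flip: e_mult)
  define C where "C = e (u 1) \<oplus>\<^bsub>A\<^esub> e (u (-1))"
  have C_carrier [simp]: "C \<in> carrier A" by (simp add: C_def)
  have comm_mult: "e (g \<otimes>\<^bsub>G\<^esub> h) \<otimes>\<^bsub>A\<^esub> C = C \<otimes>\<^bsub>A\<^esub> e (g \<otimes>\<^bsub>G\<^esub> h)"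
    if g: "e g \<otimes>\<^bsub>A\<^esub> C = C \<otimes>\<^bsub>A\<^esub> e g" "g \<in> carrier G"
      and h: "e h \<otimes>\<^bsub>A\<^esub> C = C \<otimes>\<^bsub>A\<^esub> e h" "h \<in> carrier G" for g h
  proof -
    have "e (g \<otimes>\<^bsub>G\<^esub> h) \<otimes>\<^bsub>A\<^esub> C = e g \<otimes>\<^bsub>A\<^esub> (e h \<otimes>\<^bsub>A\<^esub> C)"
      using g(2) h(2) by (simp add: e_mult A.m_assoc)
    also have "\<dots> = e g \<otimes>\<^bsub>A\<^esub> C \<otimes>\<^bsub>A\<^esub> e h"
      unfolding h(1) using g(2) h(2) by (simp add: A.m_assoc)
    finally show ?thesis
      unfolding g(1) using g(2) h(2) by (simp add: e_mult A.m_assoc)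
  qed
  have comm_w: "e w \<otimes>\<^bsub>A\<^esub> C = C \<otimes>\<^bsub>A\<^esub> e w"
    unfolding C_def using X2 W2
    by (intro A.inverse_sum_commutes) (simp_all add: e_u_mult u_zero e_one x_eq e_mult)
  have comm_u: "e (u k) \<otimes>\<^bsub>A\<^esub> C = C \<otimes>\<^bsub>A\<^esub> e (u k)" for k
    by (simp add: C_def A.l_distr A.r_distr e_u_mult add.commute)

  obtain q where q: "r * r = 2 + int p * q"
    using r by (metis cong_iff_lin cong_sym)
  obtain c where c: "2 * c = int p + 1"
    using p_odd by (metis dvdE even_add odd_one of_nat_1 even_of_nat of_nat_add)
  \<comment> \<open>As \<open>c\<close> inverts 2 modulo \<open>p\<close> and \<open>r\<close> squares to 2, \<open>s\<close> inverts \<open>r\<close>.\<close>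
  define s where "s = r * c"
  have "r * s = 2 * c + int p * (q * c)"
    unfolding s_def mult.assoc[symmetric] q by (simp add: distrib_right mult.assoc)
  moreover have "2 * s = r * (2 * c)"
    by (simp add: s_def)
  ultimately have s: "r * s = 1 + int p * (1 + q * c)" "2 * s = r + int p * r"
    unfolding c by (simp_all add: algebra_simps)
  \<comment> \<open>The usual expression of a diagonal matrix by unipotent ones, with \<open>w\<close> in place of its
    inverse \<open>- w\<close>; this changes only the sign, which cancels in the conjugation.\<close>
  define h where
    "h = u r \<otimes>\<^bsub>G\<^esub> w \<otimes>\<^bsub>G\<^esub> u s \<otimes>\<^bsub>G\<^esub> w \<otimes>\<^bsub>G\<^esub> u r \<otimes>\<^bsub>G\<^esub> w"
  define h' where "h' = M (- s) 0 0 (- r)"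
  have h: "h = M (- r) 0 0 (- s)"
  proof -
    have "h = M (r * (r * s - 1) - r) (1 - r * s) (r * s - 1) (- s)"
      by (simp add: h_def u_def w_def mat_mult algebra_simps)
    also have "\<dots> = M (- r) 0 0 (- s)"
      unfolding s by (simp add: mat_eq_iff cong_iff_dvd_diff)
    finally show ?thesis .
  qed
  have hcar [simp]: "h \<in> carrier G" "h' \<in> carrier G"
    using s by (simp_all add: h h'_def mat_carrier_iff mult.commute[of s] cong_iff_dvd_diff)
  have h_h': "h \<otimes>\<^bsub>G\<^esub> h' = \<one>\<^bsub>G\<^esub>"
    using s by (simp add: h h'_def mat_mult mat_one mat_eq_iff mult.commute[of s] cong_iff_dvd_diff)
  have h_u: "h \<otimes>\<^bsub>G\<^esub> u k = u (2 * k) \<otimes>\<^bsub>G\<^esub> h" for k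
  proof -
    have "2 * k * s = k * (2 * s)" by simp
    also have "\<dots> = k * r + int p * (k * r)" unfolding s(2) by (simp add: algebra_simps)
    finally have "2 * k * s = k * r + int p * (k * r)" .
    then show ?thesis
      by (simp add: h u_def mat_mult mat_eq_iff cong_iff_dvd_diff mult.commute[of k])
  qed
  have comm_h: "e h \<otimes>\<^bsub>A\<^esub> C = C \<otimes>\<^bsub>A\<^esub> e h"
    unfolding h_def by (intro comm_mult comm_u comm_w) simp_all
  have "C \<otimes>\<^bsub>A\<^esub> e h = (e (u 2) \<oplus>\<^bsub>A\<^esub> e (u (-2))) \<otimes>\<^bsub>A\<^esub> e h"
    unfolding comm_h[symmetric] using h_u[of 1] h_u[of "-1"]
    by (simp add: C_def A.l_distr A.r_distr flip: e_mult)
  then have "C \<otimes>\<^bsub>A\<^esub> e h \<otimes>\<^bsub>A\<^esub> e h' = (e (u 2) \<oplus>\<^bsub>A\<^esub> e (u (-2))) \<otimes>\<^bsub>A\<^esub> e h \<otimes>\<^bsub>A\<^esub> e h'"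
    by simp
  then have C2: "C = e (u 2) \<oplus>\<^bsub>A\<^esub> e (u (-2))"
    by (simp add: A.m_assoc h_h' e_one flip: e_mult)

  have "e (u 1) \<otimes>\<^bsub>A\<^esub> e (u 1) \<otimes>\<^bsub>A\<^esub> e (u 1) \<otimes>\<^bsub>A\<^esub> (e (u 1) \<otimes>\<^bsub>A\<^esub> e (u 1) \<otimes>\<^bsub>A\<^esub> e (u 1)) =
    e (u 1) \<otimes>\<^bsub>A\<^esub> e (u 1) \<otimes>\<^bsub>A\<^esub> e (u 1) \<oplus>\<^bsub>A\<^esub> (e (u 1) \<otimes>\<^bsub>A\<^esub> e (u 1) \<otimes>\<^bsub>A\<^esub> e (u 1) \<ominus>\<^bsub>A\<^esub> \<one>\<^bsub>A\<^esub>)"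
    by (rule A.cube_unipotent[where V = "e (u (-1))"])
       (use C2 in \<open>simp_all add: C_def e_u_mult u_zero e_one\<close>)
  then have T: "e (u 3) \<otimes>\<^bsub>A\<^esub> e (u 3) = e (u 3) \<oplus>\<^bsub>A\<^esub> (e (u 3) \<ominus>\<^bsub>A\<^esub> \<one>\<^bsub>A\<^esub>)"
    by (simp add: e_u_mult)
  have T_pow: "e (u 3) [^]\<^bsub>A\<^esub> k = e (u (3 * int k))" for k :: nat
    by (induction k) (simp_all add: u_zero e_one e_u_mult algebra_simps)
  have "u (3 * int p) = \<one>\<^bsub>G\<^esub>"
    by (simp add: u_def mat_one mat_eq_iff cong_iff_dvd_diff)
  then have T_p: "e (u 3) [^]\<^bsub>A\<^esub> p = \<one>\<^bsub>A\<^esub>"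
    by (simp add: T_pow e_one)

  \<comment> \<open>The powers of \<open>u 3\<close> run through the subgroup of all \<open>u k\<close> since 3 is prime to \<open>p\<close>.\<close>
  have "coprime 3 p"
    using p_prime p by (intro primes_coprime) auto
  then have cop: "coprime 3 (int p)"
    by (metis coprime_int_iff of_nat_numeral)
  have inj: "inj_on (\<lambda>k. u (3 * int k)) {..<p}"
  proof (rule inj_onI)
    fix k l assume kl: "k \<in> {..<p}" "l \<in> {..<p}" "u (3 * int k) = u (3 * int l)"
    then have "[int k = int l] (mod int p)"
      using cop by (simp add: u_def unipotent_eq_iff cong_mult_lcancel)
    then show "k = l"
      using kl by (simp add: cong_int_iff cong_less_modulus_unique_nat)
  qed
  have range_u: "range u = (\<lambda>k. u (3 * int k)) ` {..<p}"
  proof (intro equalityI subsetI)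
    fix y assume "y \<in> range u"
    then obtain k where y: "y = u k" by auto
    obtain d where d: "[3 * d = 1] (mod int p)"
      using cong_solve_coprime_int[OF cop] by auto
    define l where "l = nat ((d * k) mod int p)"
    have l: "int l = (d * k) mod int p"
      using p by (simp add: l_def)
    have "[3 * int l = 3 * (d * k)] (mod int p)"
      unfolding l by (intro cong_mult cong_refl) simp
    also have "3 * (d * k) = 3 * d * k" by simp
    also have "[\<dots> = 1 * k] (mod int p)"
      using d by (rule cong_mult) simp
    finally have "y = u (3 * int l)"
      by (simp add: y u_def unipotent_eq_iff cong_sym_eq)
    moreover have "l < p"
      using p l by (metis of_nat_less_iff pos_mod_bound of_nat_0_less_iff gr_implies_not0 neq0_conv)
    ultimately show "y \<in> (\<lambda>k. u (3 * int k)) ` {..<p}" by auto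
  qed auto
  have "range u \<noteq> {\<one>\<^bsub>G\<^esub>}"
  proof -
    have "u 1 \<noteq> u 0" by (simp add: u_def unipotent_eq_iff not_cong)
    then show ?thesis unfolding u_zero by blast
  qed
  moreover have "subgroup (range u) G"
    using unipotent_subgroup by (simp add: u_def)
  ultimately have "(\<Oplus>\<^bsub>A\<^esub>h\<in>range u. e h) = \<zero>\<^bsub>A\<^esub>"
    by (intro e_sum)
  then have "(\<Oplus>\<^bsub>A\<^esub>k\<in>{..<p}. e (u 3) [^]\<^bsub>A\<^esub> k) = \<zero>\<^bsub>A\<^esub>"
    unfolding range_u using inj by (subst (asm) A.finsum_reindex) (auto simp: T_pow)
  then have "[p] \<cdot>\<^bsub>A\<^esub> \<one>\<^bsub>A\<^esub> = \<zero>\<^bsub>A\<^esub>"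
    using T T_p p_odd by (intro A.unipotent_char[of "e (u 3)"]) simp_all
  then show ?thesis
    unfolding A_def by (rule G.char_in_scharlau_ideal)
qed

end

section \<open>The natural representation annihilates the Scharlau ideal\<close>

text \<open>The indices are Booleans: \<open>False\<close> is the first and \<open>True\<close> the second row or column.\<close>

fun entry :: "bool \<Rightarrow> bool \<Rightarrow> int \<times> int \<times> int \<times> int \<Rightarrow> int" where
  "entry i j (a, b, c, d) = (if i then if j then d else c else if j then b else a)"

context residues_prime
begin

lemma entry_mult:
  "[entry i j (x \<otimes>\<^bsub>G\<^esub> y) = entry i False x * entry False j y + entry i True x * entry True j y]
    (mod int p)"
  by (cases x; cases y; cases i; cases j) (simp_all add: SL2_def res_add_eq res_mult_eq mod_simps cong_def)

definition natural_rep :: "(int \<times> int \<times> int \<times> int \<Rightarrow> int) \<Rightarrow> bool \<Rightarrow> bool \<Rightarrow> int" where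
  "natural_rep f i j = (\<Sum>x\<in>carrier G. f x * entry i j x)"

definition natural_kernel :: "(int \<times> int \<times> int \<times> int \<Rightarrow> int) set" where
  "natural_kernel = {f \<in> carrier (int_group_ring G). \<forall>i j. [natural_rep f i j = 0] (mod int p)}"

lemma natural_rep_mult:
  assumes f: "f \<in> carrier (int_group_ring G)" and g: "g \<in> carrier (int_group_ring G)"
  shows "[natural_rep (f \<otimes>\<^bsub>int_group_ring G\<^esub> g) i j =
    natural_rep f i False * natural_rep g False j + natural_rep f i True * natural_rep g True j]
    (mod int p)"
proof -
  interpret G: group G by (rule SL2_group)
  let ?C = "carrier G"
  have supp: "{x. f x \<noteq> 0} \<subseteq> ?C" "{x. g x \<noteq> 0} \<subseteq> ?C"
    using f g by (auto simp: int_group_ring_def)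
  have "natural_rep (f \<otimes>\<^bsub>int_group_ring G\<^esub> g) i j =
      (\<Sum>x\<in>?C. \<Sum>y\<in>?C. \<Sum>z\<in>?C. if y \<otimes>\<^bsub>G\<^esub> z = x then f y * g z * entry i j x else 0)"
    unfolding natural_rep_def
    by (subst int_group_ring_mult_eq[OF finite_SL2 finite_SL2 supp])
       (auto simp: sum_distrib_right intro!: sum.cong)
  also have "\<dots> = (\<Sum>y\<in>?C. \<Sum>x\<in>?C. \<Sum>z\<in>?C. if y \<otimes>\<^bsub>G\<^esub> z = x then f y * g z * entry i j x else 0)"
    by (rule sum.swap)
  also have "\<dots> = (\<Sum>y\<in>?C. \<Sum>z\<in>?C. \<Sum>x\<in>?C. if y \<otimes>\<^bsub>G\<^esub> z = x then f y * g z * entry i j x else 0)"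
    by (rule sum.cong[OF refl], rule sum.swap)
  also have "\<dots> = (\<Sum>y\<in>?C. \<Sum>z\<in>?C. f y * g z * entry i j (y \<otimes>\<^bsub>G\<^esub> z))"
    using finite_SL2 by (intro sum.cong refl, subst sum.delta') auto
  also have "[\<dots> = (\<Sum>y\<in>?C. \<Sum>z\<in>?C.
      f y * g z * (entry i False y * entry False j z + entry i True y * entry True j z))] (mod int p)"
    by (intro cong_sum cong_mult cong_refl entry_mult)
  also have "(\<Sum>y\<in>?C. \<Sum>z\<in>?C.
      f y * g z * (entry i False y * entry False j z + entry i True y * entry True j z)) =
    natural_rep f i False * natural_rep g False j + natural_rep f i True * natural_rep g True j"
    unfolding natural_rep_def sum_product sum.distrib[symmetric]
    by (intro sum.cong refl) (simp add: algebra_simps)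
  finally show ?thesis .
qed

lemma natural_kernel_ideal: "ideal natural_kernel (int_group_ring G)"
proof (rule idealI)
  let ?R = "int_group_ring G"
  show R: "ring ?R" by (rule int_group_ring_ring[OF SL2_group])
  interpret ZG: ring ?R by fact
  show "subgroup natural_kernel (add_monoid ?R)"
  proof (rule ZG.add.subgroupI)
    show "natural_kernel \<subseteq> carrier ?R" by (auto simp: natural_kernel_def)
    have "natural_rep \<zero>\<^bsub>?R\<^esub> i j = 0" for i j
      by (simp add: natural_rep_def int_group_ring_def)
    then show "natural_kernel \<noteq> {}"
      by (auto simp: natural_kernel_def intro!: exI[of _ "\<zero>\<^bsub>?R\<^esub>"])
  next
    fix f assume f: "f \<in> natural_kernel"
    then have fc: "f \<in> carrier ?R" by (simp add: natural_kernel_def)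
    have "natural_rep (\<ominus>\<^bsub>?R\<^esub> f) i j = - natural_rep f i j" for i j
      using fc by (simp add: natural_rep_def int_group_ring_uminus[OF SL2_group] sum_negf)
    then show "\<ominus>\<^bsub>?R\<^esub> f \<in> natural_kernel"
      using f fc by (auto simp: natural_kernel_def cong_0_iff)
  next
    fix f g assume fg: "f \<in> natural_kernel" "g \<in> natural_kernel"
    have "natural_rep (f \<oplus>\<^bsub>?R\<^esub> g) i j = natural_rep f i j + natural_rep g i j" for i j
      by (simp add: natural_rep_def int_group_ring_def sum.distrib distrib_right)
    then show "f \<oplus>\<^bsub>?R\<^esub> g \<in> natural_kernel"
      using fg by (auto simp: natural_kernel_def cong_0_iff)
  qed
  fix f g assume f: "f \<in> natural_kernel" and g: "g \<in> carrier ?R"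
  have fc: "f \<in> carrier ?R" and f0: "int p dvd natural_rep f i j" for i j
    using f by (auto simp: natural_kernel_def cong_0_iff)
  have "int p dvd natural_rep (g \<otimes>\<^bsub>?R\<^esub> f) i j" for i j
    using natural_rep_mult[OF g fc, of i j] f0 by (simp add: cong_dvd_iff)
  then show "g \<otimes>\<^bsub>?R\<^esub> f \<in> natural_kernel"
    using fc g by (auto simp: natural_kernel_def cong_0_iff)
  have "int p dvd natural_rep (f \<otimes>\<^bsub>?R\<^esub> g) i j" for i j
    using natural_rep_mult[OF fc g, of i j] f0 by (simp add: cong_dvd_iff)
  then show "f \<otimes>\<^bsub>?R\<^esub> g \<in> natural_kernel"
    using fc g by (auto simp: natural_kernel_def cong_0_iff)
qed

lemma entry_M: "[entry i j (M a b c d) = (if i then if j then d else c else if j then b else a)] (mod int p)"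
  by (simp add: mat_mod_def cong_def)

text \<open>The powers of \<open>h = 1 + N\<close> with \<open>N\<^sup>2 = 0\<close> are \<open>1 + t N\<close>. Over a coset of the group that they
  form, the matrices sum to \<open>p x + (\<Sum>t<p. t) N x\<close>, and both coefficients are divisible by the
  odd number \<open>p\<close>.\<close>

lemma subgroup_sum_of_unipotent:
  assumes H: "subgroup H G" and h: "h \<in> H" "h \<noteq> \<one>\<^bsub>G\<^esub>"
    and h_eq: "h = M (1 + n) b c (1 - n)" and nil: "[n * n + b * c = 0] (mod int p)"
    and p: "odd p"
  shows "[(\<Sum>x\<in>H. entry i j x) = 0] (mod int p)"
proof -
  interpret G: group G by (rule SL2_group)
  define k where "k t = M (1 + t * n) (t * b) (t * c) (1 - t * n)" for t
  have k_mult: "k s \<otimes>\<^bsub>G\<^esub> k t = k (s + t)" for s t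
  proof -
    have "int p dvd s * t * (n * n + b * c)"
      using nil by (simp add: cong_0_iff)
    then show ?thesis
      by (simp add: k_def mat_mult mat_eq_iff cong_iff_dvd_diff algebra_simps)
  qed
  have k0: "k 0 = \<one>\<^bsub>G\<^esub>" by (simp add: k_def mat_one)
  have k1: "k 1 = h" by (simp add: k_def h_eq)
  have k_eq: "k s = k t" if "[s = t] (mod int p)" for s t
    using that unfolding k_def mat_eq_iff by (intro conjI cong_add cong_diff cong_mult cong_refl)
  have k_nat: "k (int t) \<in> H" for t :: nat
  proof (induction t)
    case (Suc t)
    have "k (int (Suc t)) = h \<otimes>\<^bsub>G\<^esub> k (int t)" by (simp add: k1[symmetric] k_mult)
    with Suc show ?case using h(1) H by (simp add: subgroup.m_closed)
  qed (use H in \<open>simp add: k0 subgroup.one_closed\<close>)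
  have p0: "0 < int p" using p_prime by (simp add: prime_gt_0_nat)
  have k_range: "k t \<in> (\<lambda>t. k (int t)) ` {..<p}" for t
  proof (rule image_eqI)
    show "k t = k (int (nat (t mod int p)))"
      using p0 by (intro k_eq) simp
    show "nat (t mod int p) \<in> {..<p}"
      using p0 by (simp add: nat_less_iff)
  qed
  then have rng: "range k = (\<lambda>t. k (int t)) ` {..<p}" by blast
  have KH: "range k \<subseteq> H" unfolding rng using k_nat by blast
  have HG: "H \<subseteq> carrier G" by (rule subgroup.subset[OF H])
  have K: "subgroup (range k) G"
  proof (rule G.finite_subgroupI)
    show "finite (range k)" unfolding rng by simp
    show "range k \<subseteq> carrier G" using KH HG by blast
    show "\<one>\<^bsub>G\<^esub> \<in> range k" unfolding k0[symmetric] by blast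
  qed (simp add: k_mult)
  have inj: "inj_on (\<lambda>t. k (int t)) {..<p}"
  proof (rule inj_onI, rule ccontr)
    fix s t assume st: "s \<in> {..<p}" "t \<in> {..<p}" "k (int s) = k (int t)" "s \<noteq> t"
    have "\<not> [int s = int t] (mod int p)"
      using st by (auto simp: cong_int_iff dest: cong_less_modulus_unique_nat)
    then have cop: "coprime (int s - int t) (int p)"
      using p_prime by (metis cong_iff_dvd_diff coprime_commute prime_imp_coprime prime_int_nat_transfer prime_nat_int_transfer)
    have "k (int s - int t) = k (int t + (- int t))"
    proof -
      have "k (int s - int t) = k (int s) \<otimes>\<^bsub>G\<^esub> k (- int t)" by (simp add: k_mult)
      then show ?thesis unfolding st(3) k_mult .
    qed
    then have "k (int s - int t) = \<one>\<^bsub>G\<^esub>" by (simp add: k0)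
    then have "int p dvd (int s - int t) * n" "int p dvd (int s - int t) * b" "int p dvd (int s - int t) * c"
      by (auto simp: k_def mat_one mat_eq_iff cong_iff_dvd_diff)
    then have "int p dvd n" "int p dvd b" "int p dvd c"
      using cop by (simp_all add: coprime_dvd_mult_right_iff coprime_commute)
    then have "h = \<one>\<^bsub>G\<^esub>" by (simp add: h_eq mat_one mat_eq_iff cong_iff_dvd_diff)
    with h show False by simp
  qed
  have gauss: "int p dvd (\<Sum>t<p. int t)"
  proof -
    have "(\<Sum>t<p. t) = p * ((p - 1) div 2)"
      using p by (auto simp: Sum_Ico_nat lessThan_atLeast0 elim!: oddE)
    then have "(\<Sum>t<p. int t) = int (p * ((p - 1) div 2))"
      by (simp flip: of_nat_sum)
    then show ?thesis by simp
  qed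
  show ?thesis
  proof (rule G.sum_cong_zero_of_cosets[OF K H _ KH])
    show "finite H" using HG finite_SL2 by (rule finite_subset)
    fix x
    define y where "y = (if i then c * entry False j x - n * entry True j x
      else n * entry False j x + b * entry True j x)"
    have "[entry i j (k t \<otimes>\<^bsub>G\<^esub> x) = entry i j x + t * y] (mod int p)" for t
    proof -
      have "[entry i j (k t \<otimes>\<^bsub>G\<^esub> x) = entry i False (k t) * entry False j x + entry i True (k t) * entry True j x] (mod int p)"
        by (rule entry_mult)
      also have "[entry i False (k t) * entry False j x + entry i True (k t) * entry True j x =
          (if i then t * c else 1 + t * n) * entry False j x +
          (if i then 1 - t * n else t * b) * entry True j x] (mod int p)"
        using entry_M[of i False "1 + t * n" "t * b" "t * c" "1 - t * n"]
          entry_M[of i True "1 + t * n" "t * b" "t * c" "1 - t * n"]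
        by (intro cong_add cong_mult cong_refl) (auto simp: k_def)
      also have "(if i then t * c else 1 + t * n) * entry False j x +
          (if i then 1 - t * n else t * b) * entry True j x = entry i j x + t * y"
        by (cases i) (simp_all add: y_def algebra_simps)
      finally show ?thesis .
    qed
    then have "[(\<Sum>t<p. entry i j (k (int t) \<otimes>\<^bsub>G\<^esub> x)) = (\<Sum>t<p. entry i j x + int t * y)] (mod int p)"
      by (intro cong_sum)
    also have "(\<Sum>t<p. entry i j x + int t * y) = int p * entry i j x + (\<Sum>t<p. int t) * y"
      by (simp add: sum.distrib sum_distrib_right)
    also have "[\<dots> = 0] (mod int p)"
      using gauss by (simp add: cong_0_iff)
    finally show "[(\<Sum>g\<in>range k. entry i j (g \<otimes>\<^bsub>G\<^esub> x)) = 0] (mod int p)"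
      unfolding rng by (simp add: sum.reindex[OF inj])
  qed
qed

text \<open>The sum \<open>S\<close> satisfies \<open>h S = S\<close>, and \<open>h - 1\<close> has determinant \<open>2 - tr h\<close>, a unit. The
  adjugate of \<open>h - 1\<close> turns \<open>(h - 1) S = 0\<close> into \<open>(2 - tr h) S = 0\<close>.\<close>

lemma subgroup_sum_of_fixed_point_free:
  assumes H: "subgroup H G" and h: "h \<in> H" "h = M a b c d"
    and det: "[a * d - b * c = 1] (mod int p)" and tr: "\<not> [a + d = 2] (mod int p)"
  shows "[(\<Sum>x\<in>H. entry i j x) = 0] (mod int p)"
proof -
  interpret G: group G by (rule SL2_group)
  define S where "S i = (\<Sum>x\<in>H. entry i j x)" for i
  have HG: "H \<subseteq> carrier G" by (rule subgroup.subset[OF H])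
  have inj: "inj_on (\<lambda>x. h \<otimes>\<^bsub>G\<^esub> x) H"
    using h(1) HG by (intro inj_on_subset[OF G.inj_on_cmult HG]) auto
  have "(\<lambda>x. h \<otimes>\<^bsub>G\<^esub> x) ` H = H"
    using inj finite_subset[OF HG finite_SL2] h(1) H
    by (intro endo_inj_surj) (auto simp: subgroup.m_closed)
  then have "S i = (\<Sum>x\<in>H. entry i j (h \<otimes>\<^bsub>G\<^esub> x))" for i
    unfolding S_def using sum.reindex[OF inj, of "entry i j"] by simp
  note S_h = this
  have S_cong: "[(\<Sum>x\<in>H. entry i j (h \<otimes>\<^bsub>G\<^esub> x)) =
      (\<Sum>x\<in>H. (if i then c else a) * entry False j x + (if i then d else b) * entry True j x)] (mod int p)" for i
  proof (rule cong_sum)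
    fix x
    have "[entry i j (h \<otimes>\<^bsub>G\<^esub> x) = entry i False h * entry False j x + entry i True h * entry True j x] (mod int p)"
      by (rule entry_mult)
    also have "[entry i False h * entry False j x + entry i True h * entry True j x =
      (if i then c else a) * entry False j x + (if i then d else b) * entry True j x] (mod int p)"
      using entry_M[of i False a b c d] entry_M[of i True a b c d] unfolding h(2) by (intro cong_add cong_mult cong_refl) auto
    finally show "[entry i j (h \<otimes>\<^bsub>G\<^esub> x) = (if i then c else a) * entry False j x + (if i then d else b) * entry True j x] (mod int p)" .
  qed
  have S: "[S i = (if i then c else a) * S False + (if i then d else b) * S True] (mod int p)" for i
    using S_cong[of i] unfolding S_h[symmetric] by (simp add: S_def sum.distrib sum_distrib_left)
  obtain A B D where A: "S False - (a * S False + b * S True) = int p * A"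
    and B: "S True - (c * S False + d * S True) = int p * B"
    and D: "a * d - b * c - 1 = int p * D"
    using S[of False] S[of True] det by (auto simp: cong_iff_dvd_diff elim!: dvdE)
  have "(2 - (a + d)) * S False = (1 - d) * (S False - (a * S False + b * S True))
      + b * (S True - (c * S False + d * S True)) - (a * d - b * c - 1) * S False"
    by (simp add: algebra_simps)
  also have "int p dvd \<dots>" unfolding A B D by simp
  finally have F: "int p dvd (2 - (a + d)) * S False" .
  have "(2 - (a + d)) * S True = (1 - a) * (S True - (c * S False + d * S True))
      + c * (S False - (a * S False + b * S True)) - (a * d - b * c - 1) * S True"
    by (simp add: algebra_simps)
  also have "int p dvd \<dots>" unfolding A B D by simp
  finally have T: "int p dvd (2 - (a + d)) * S True" .
  have "\<not> int p dvd 2 - (a + d)"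
    using tr by (simp add: cong_iff_dvd_diff dvd_diff_commute)
  then have "int p dvd S i" for i
    using F T p_prime by (cases i) (auto simp: prime_dvd_mult_iff)
  then show ?thesis by (simp add: S_def cong_0_iff)
qed

lemma subgroup_sum_entry:
  assumes H: "subgroup H G" "H \<noteq> {\<one>\<^bsub>G\<^esub>}" and p: "odd p"
  shows "[(\<Sum>x\<in>H. entry i j x) = 0] (mod int p)"
proof -
  obtain h where h: "h \<in> H" "h \<noteq> \<one>\<^bsub>G\<^esub>"
    using H subgroup.one_closed[OF H(1)] by blast
  then obtain a b c d where abcd: "h = M a b c d" "[a * d - b * c = 1] (mod int p)"
    using subgroup.subset[OF H(1)] by (blast elim: SL2_carrierE)
  show ?thesis
  proof (cases "[a + d = 2] (mod int p)")
    case False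
    then show ?thesis using subgroup_sum_of_fixed_point_free[OF H(1) h(1) abcd] by blast
  next
    case True
    \<comment> \<open>The characteristic polynomial of \<open>h\<close> is that of the identity, so \<open>h - 1\<close> squares to 0.\<close>
    then have d: "[d = 1 - (a - 1)] (mod int p)"
      by (simp add: cong_iff_dvd_diff algebra_simps)
    then have h_eq: "h = M (1 + (a - 1)) b c (1 - (a - 1))"
      by (simp add: abcd(1) mat_eq_iff)
    have "[a * (1 - (a - 1)) - b * c = a * d - b * c] (mod int p)"
      using d by (intro cong_diff cong_mult cong_refl) (rule cong_sym)
    also note abcd(2)
    finally have "int p dvd 1 - (a * (1 - (a - 1)) - b * c)"
      by (simp add: cong_iff_dvd_diff dvd_diff_commute)
    then have "[(a - 1) * (a - 1) + b * c = 0] (mod int p)"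
      by (simp add: cong_0_iff algebra_simps)
    then show ?thesis by (rule subgroup_sum_of_unipotent[OF H(1) h h_eq _ p])
  qed
qed

lemma scharlau_ideal_subset_natural_kernel:
  assumes p: "odd p"
  shows "scharlau_ideal G \<subseteq> natural_kernel"
  unfolding scharlau_ideal_def
proof (rule ring.genideal_minimal[OF int_group_ring_ring[OF SL2_group] natural_kernel_ideal], rule subsetI)
  interpret G: group G by (rule SL2_group)
  fix f assume "f \<in> {subset_sum G H | H. subgroup H G \<and> H \<noteq> {\<one>\<^bsub>G\<^esub>}}"
  then obtain H where f: "f = subset_sum G H" and H: "subgroup H G" "H \<noteq> {\<one>\<^bsub>G\<^esub>}"
    by blast
  have HG: "H \<subseteq> carrier G" by (rule subgroup.subset[OF H(1)])
  have "natural_rep (subset_sum G H) i j = (\<Sum>x\<in>H. entry i j x)" for i j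
    unfolding natural_rep_def subset_sum_eq[OF SL2_group finite_subset[OF HG finite_SL2] HG]
    by (rule sum.mono_neutral_cong_right) (use HG finite_SL2 in auto)
  then show "f \<in> natural_kernel"
    unfolding f using subgroup_sum_entry[OF H p] G.subset_sum_carrier[OF HG] by (simp add: natural_kernel_def)
qed

lemma scharlau_ideal_multiples:
  assumes p: "p > 3" and r: "[r * r = 2] (mod int p)"
  shows "[k] \<cdot>\<^bsub>int_group_ring G\<^esub> \<one>\<^bsub>int_group_ring G\<^esub> \<in> scharlau_ideal G \<longleftrightarrow> int p dvd k"
proof -
  let ?R = "int_group_ring G"
  interpret G: group G by (rule SL2_group)
  interpret ZG: ring ?R by (rule int_group_ring_ring[OF SL2_group])
  have p_odd: "odd p"
    using prime_odd_nat[OF p_prime] p by simp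
  note pow = int_group_ring_add_pow[OF SL2_group]
  have one: "\<one>\<^bsub>?R\<^esub> = (\<lambda>x. if x = \<one>\<^bsub>G\<^esub> then 1 else 0)"
    by (simp add: int_group_ring_def)
  show ?thesis
  proof
    assume "[k] \<cdot>\<^bsub>?R\<^esub> \<one>\<^bsub>?R\<^esub> \<in> scharlau_ideal G"
    then have "[k] \<cdot>\<^bsub>?R\<^esub> \<one>\<^bsub>?R\<^esub> \<in> natural_kernel"
      using scharlau_ideal_subset_natural_kernel[OF p_odd] by (rule subsetD[rotated])
    then have "int p dvd natural_rep ([k] \<cdot>\<^bsub>?R\<^esub> \<one>\<^bsub>?R\<^esub>) False False"
      by (simp add: natural_kernel_def cong_0_iff)
    also have "natural_rep ([k] \<cdot>\<^bsub>?R\<^esub> \<one>\<^bsub>?R\<^esub>) False False =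
        (\<Sum>x\<in>carrier G. if x = \<one>\<^bsub>G\<^esub> then k * entry False False x else 0)"
      unfolding natural_rep_def pow[OF ZG.one_closed] by (intro sum.cong refl) (simp add: one)
    also have "\<dots> = k * entry False False \<one>\<^bsub>G\<^esub>"
      using finite_SL2 by (subst sum.delta) auto
    also have "\<dots> = k"
      by (simp add: SL2_def res_one_eq)
    finally show "int p dvd k" .
  next
    assume "int p dvd k"
    then obtain l where k: "k = int p * l" by blast
    interpret ideal "scharlau_ideal G" ?R by (rule G.scharlau_ideal_ideal)
    have "[k] \<cdot>\<^bsub>?R\<^esub> \<one>\<^bsub>?R\<^esub> = [l] \<cdot>\<^bsub>?R\<^esub> ([int p] \<cdot>\<^bsub>?R\<^esub> \<one>\<^bsub>?R\<^esub>)"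
      by (simp add: k ZG.add.int_pow_pow)
    also have "\<dots> = [l] \<cdot>\<^bsub>?R\<^esub> \<one>\<^bsub>?R\<^esub> \<otimes>\<^bsub>?R\<^esub> [int p] \<cdot>\<^bsub>?R\<^esub> \<one>\<^bsub>?R\<^esub>"
      by (simp add: ZG.add_pow_ldistr_int)
    also have "\<dots> \<in> scharlau_ideal G"
      using characteristic_in_scharlau_ideal[OF p r] by (intro I_l_closed) simp_all
    finally show "[k] \<cdot>\<^bsub>?R\<^esub> \<one>\<^bsub>?R\<^esub> \<in> scharlau_ideal G" .
  qed
qed

end

section \<open>The Scharlau invariant for Fermat primes\<close>

lemma scharlau_invariant_eqI:
  assumes "\<And>k. [k] \<cdot>\<^bsub>int_group_ring G\<^esub> \<one>\<^bsub>int_group_ring G\<^esub> \<in> scharlau_ideal G \<longleftrightarrow> int n dvd k"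
  shows "scharlau_invariant G = n"
proof -
  have *: "{k::int. [k] \<cdot>\<^bsub>int_group_ring G\<^esub> \<one>\<^bsub>int_group_ring G\<^esub> \<in> scharlau_ideal G} = Idl\<^bsub>\<Z>\<^esub> {int n}"
    by (auto simp: assms int_Idl dvd_def mult.commute)
  show ?thesis
    unfolding scharlau_invariant_def *
  proof (rule the_equality)
    fix d assume "Idl\<^bsub>\<Z>\<^esub> {int n} = Idl\<^bsub>\<Z>\<^esub> {int d}"
    then show "d = n"
      using dvds_eq_Idl[of "int n" "int d"] by (auto intro: dvd_antisym)
  qed (rule refl)
qed

text \<open>For \<open>p = t\<^sup>4 + 1\<close> the element \<open>t\<close> is a primitive eighth root of unity modulo \<open>p\<close>, and
  \<open>t + t\<^sup>-\<^sup>1 = t - t\<^sup>3\<close> squares to 2, as does its negative. A Fermat prime has this form, with \<open>t\<close> a power of 2, as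
  soon as its exponent is divisible by 4, which excludes only 3 and 5.\<close>

lemma fermat_prime_sqrt_two:
  assumes "fermat_prime p" "p \<ge> 17"
  obtains r where "[r * r = 2] (mod int p)"
proof -
  obtain n where n: "p = 2 ^ (2 ^ n) + 1"
    using assms(1) by (auto simp: fermat_prime_def)
  have "2 \<le> n"
  proof (rule ccontr)
    assume "\<not> 2 \<le> n"
    then have "n = 0 \<or> n = 1" by auto
    then show False using n assms(2) by auto
  qed
  then obtain m where m: "n = m + 2"
    using le_Suc_ex[of 2 n] by (auto simp: add.commute)
  define t :: int where "t = 2 ^ (2 ^ m)"
  have "int p = (2 ^ (2 ^ m)) ^ 4 + 1"
    by (simp add: n m power_add flip: power_mult)
  then have p: "int p = t ^ 4 + 1" by (simp add: t_def)
  have "(t * (t ^ 2 - 1)) * (t * (t ^ 2 - 1)) - 2 = int p * (t ^ 2 - 2)"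
    unfolding p by (simp add: algebra_simps power2_eq_square power4_eq_xxxx)
  then have "[(t * (t ^ 2 - 1)) * (t * (t ^ 2 - 1)) = 2] (mod int p)"
    by (simp add: cong_iff_dvd_diff)
  then show thesis by (rule that)
qed

theorem mainTheorem2:
  fixes p :: nat
  assumes "fermat_prime p" and "p \<ge> 17"
  shows "scharlau_invariant (SL2 (residue_ring (int p))) = p"
proof -
  interpret residues_prime p "residue_ring (int p)"
    using assms(1) by unfold_locales (simp add: fermat_prime_def)
  obtain r where "[r * r = 2] (mod int p)"
    using assms by (rule fermat_prime_sqrt_two)
  then show ?thesis
    using assms(2) by (intro scharlau_invariant_eqI scharlau_ideal_multiples) simp_all
qed

end
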